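(* Fix a nonempty $S\subseteq[n]$ with $|S|=s$, and suppose the linear model $f(Y)=X_S^T\beta_S+\varepsilon_S$ holds. Suppose $X_S$ satisfies $$\max\Big\{\sup_{\|\theta\|_2=1}\mathbb E[\langle X_S,\theta\rangle^4]^{1/4},\ \big\|\,\|X_S\|_2\,\big\|_{\psi_1}\Big\}\le K<\infty$$ for some $K\ge1$, and that $\Lambda_S:=\mathbb E[X_SX_S^T]=x_Sx_S^T+\Sigma_S$ is invertible. Then there exist a constant $C>0$ and an integer $m_0$, not depending on the number $m$ of exploration samples nor on the budget $B$, such that for every $m\ge m_0$ (and every $B$ for which $N_S\ge1$), with probability at least $1-m^{-2}$, $$\mathrm{MSE}_S|_{\widehat\beta_S}\ \le\ C\left(\frac{\beta_S^T\Sigma_S\beta_S}{N_S}+(s+1)\,\sigma_S^2\,\frac{\log m}{m}\right).$$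
   Context: Setting. $X^{(1)},\dots,X^{(n)}$ and $f(Y)$ are real random variables on a common probability space, with sampling costs $c_1,\dots,c_n>0$ and $c_0>0$ respectively. For nonempty $S\subseteq[n]=\{1,\dots,n\}$ with $|S|=s$, $X_S=(1,(X^{(i)})_{i\in S})^T\in\mathbb R^{s+1}$. The linear model assumption is $f(Y)=X_S^T\beta_S+\varepsilon_S$ with $\beta_S\in\mathbb R^{s+1}$ deterministic and $\varepsilon_S$ centered, sub-Gaussian, with variance $\sigma_S^2$, independent of $X_S$. Write $x_S=\mathbb E[X_S]$, $\Sigma_S=\mathrm{Cov}[X_S]$. For a random variable $W$ and $\alpha\ge1$, $\|W\|_{\psi_\alpha}=\inf\{C>0:\mathbb E[\exp(|W|^\alpha/C^\alpha)]\le2\}$. Exploration. $m>n+1$ i.i.d. joint samples $(X^{(1)}_\ell,\dots,X^{(n)}_\ell,f(Y_\ell))$, $\ell\in[m]$, are drawn. $Z_S$ is the $m\times(s+1)$ design matrix whose $\ell$-th row is $(1,(X^{(i)}_\ell)_{i\in S})$, assumed throughout to have full column rank, and $\widehat\beta_S=Z_S^\dagger(f(Y_1),\dots,f(Y_m))^T$ with $Z_S^\dagger=(Z_S^TZ_S)^{-1}Z_S^T$. Exploitation. With total budget $B>0$, $c_{\mathrm{epr}}=\sum_{i=0}^nc_i$ and $c_{\mathrm{ept}}(S)=\sum_{i\in S}c_i$, let $N_S=\lfloor (B-c_{\mathrm{epr}}m)/c_{\mathrm{ept}}(S)\rfloor$. Draw $N_S$ i.i.d. samples $X_{S,\ell}$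 of $X_S$, independent of the exploration samples, and set $$\mathrm{LRMC}_S=\frac1{N_S}\sum_{\ell\in[N_S]}X_{S,\ell}^T\widehat\beta_S,\qquad \mathrm{MSE}_S|_{\widehat\beta_S}=\mathbb E\big[(\mathrm{LRMC}_S-\mathbb E[f(Y)])^2\,\big|\,\widehat\beta_S\big].$$ The probability in the claim is over the exploration data (on which $\widehat\beta_S$ depends). *)

theory Defs
  imports
    "HOL-Probability.Probability"
    "Jordan_Normal_Form.Gauss_Jordan_Elimination"
    "Jordan_Normal_Form.DL_Rank"
begin

unbundle no vec_syntax
no_notation inner (infix \<open>\<bullet>\<close> 70)

section \<open>Norms of real random variables\<close>

text \<open>
  Both norms take values in \<^typ>\<open>ennreal\<close>, so that an infinite expectation (respectively an
  empty set of admissible constants) yields the value \<open>\<infinity>\<close> and not a junk real number.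
\<close>

definition psi_norm :: "'a measure \<Rightarrow> real \<Rightarrow> ('a \<Rightarrow> real) \<Rightarrow> ennreal" where
  "psi_norm M \<alpha> W =
     Inf {ennreal C | C. C > 0 \<and>
       (\<integral>\<^sup>+\<omega>. ennreal (exp (\<bar>W \<omega>\<bar> powr \<alpha> / C powr \<alpha>)) \<partial>M) \<le> 2}"

definition L4_norm :: "'a measure \<Rightarrow> ('a \<Rightarrow> real) \<Rightarrow> ennreal" where
  "L4_norm M W =
     (let I = (\<integral>\<^sup>+\<omega>. ennreal (W \<omega> ^ 4) \<partial>M)
      in if I = \<infinity> then \<infinity> else ennreal (root 4 (enn2real I)))"

definition sub_gaussian :: "'a measure \<Rightarrow> ('a \<Rightarrow> real) \<Rightarrow> bool" where
  "sub_gaussian M W \<longleftrightarrow> W \<in> borel_measurable M \<and> psi_norm M 2 W < \<infinity>"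

section \<open>Random vectors\<close>

definition vec_norm2 :: "real vec \<Rightarrow> real" where
  "vec_norm2 v = sqrt (v \<bullet> v)"

text \<open>The Borel sigma-algebra of \<open>\<real>\<^sup>k\<close>, i.e. the one generated by the coordinate maps.\<close>

definition borel_vec :: "nat \<Rightarrow> real vec measure" where
  "borel_vec k =
     vimage_algebra (carrier_vec k) (\<lambda>v. \<lambda>i\<in>{..<k}. v $ i) (\<Pi>\<^sub>M i\<in>{..<k}. borel)"

definition cov_mat :: "'a measure \<Rightarrow> nat \<Rightarrow> ('a \<Rightarrow> real vec) \<Rightarrow> real mat" where
  "cov_mat M k V =
     mat k k (\<lambda>(i, j). \<integral>\<omega>. (V \<omega> $ i - (\<integral>\<omega>'. V \<omega>' $ i \<partial>M)) * (V \<omega> $ j - (\<integral>\<omega>'. V \<omega>' $ j \<partial>M)) \<partial>M)"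

definition second_moment_mat :: "'a measure \<Rightarrow> nat \<Rightarrow> ('a \<Rightarrow> real vec) \<Rightarrow> real mat" where
  "second_moment_mat M k V = mat k k (\<lambda>(i, j). \<integral>\<omega>. V \<omega> $ i * V \<omega> $ j \<partial>M)"

text \<open>
  Independence of two random elements. The library's \<^const>\<open>prob_space.indep_var\<close> requires both
  to have values in the same type, hence this version on the generated sigma-algebras.
\<close>

definition indep_rv ::
  "'a measure \<Rightarrow> 'b measure \<Rightarrow> ('a \<Rightarrow> 'b) \<Rightarrow> 'c measure \<Rightarrow> ('a \<Rightarrow> 'c) \<Rightarrow> bool" where
  "indep_rv M MU U MV V \<longleftrightarrow>
     U \<in> measurable M MU \<and> V \<in> measurable M MV \<and>
     prob_space.indep_set M (sets (vimage_algebra (space M) U MU)) (sets (vimage_algebra (space M) V MV))"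

section \<open>The linear model\<close>

text \<open>
  \<open>regressor S x\<close> is \<open>(1, (x\<^sub>i)\<^sub>i\<^sub>\<in>\<^sub>S)\<close>, where the elements of \<open>S\<close> are listed in increasing order.
\<close>

definition regressor :: "nat set \<Rightarrow> (nat \<Rightarrow> real) \<Rightarrow> real vec" where
  "regressor S x =
     vec (card S + 1) (\<lambda>j. if j = 0 then 1 else x (sorted_list_of_set S ! (j - 1)))"

definition XS :: "(nat \<Rightarrow> 'a \<Rightarrow> real) \<Rightarrow> nat set \<Rightarrow> 'a \<Rightarrow> real vec" where
  "XS X S \<omega> = regressor S (\<lambda>i. X i \<omega>)"

definition linear_model ::
  "'a measure \<Rightarrow> (nat \<Rightarrow> 'a \<Rightarrow> real) \<Rightarrow> ('a \<Rightarrow> real) \<Rightarrow> nat set \<Rightarrow> real vec \<Rightarrow> ('a \<Rightarrow> real) \<Rightarrow> real \<Rightarrow> bool"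
where
  "linear_model M X fY S \<beta> \<epsilon> \<sigma> \<longleftrightarrow>
     \<beta> \<in> carrier_vec (card S + 1) \<and>
     (AE \<omega> in M. fY \<omega> = XS X S \<omega> \<bullet> \<beta> + \<epsilon> \<omega>) \<and>
     sub_gaussian M \<epsilon> \<and>
     (\<integral>\<omega>. \<epsilon> \<omega> \<partial>M) = 0 \<and>
     (\<integral>\<omega>. (\<epsilon> \<omega> - (\<integral>\<omega>'. \<epsilon> \<omega>' \<partial>M))\<^sup>2 \<partial>M) = \<sigma>\<^sup>2 \<and>
     indep_rv M borel \<epsilon> (borel_vec (card S + 1)) (XS X S)"

section \<open>Exploration\<close>

text \<open>
  A joint sample of \<open>(X\<^sup>1, \<dots>, X\<^sup>n, f(Y))\<close> is a pair of a function on \<open>{1..n}\<close> and a real number.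
\<close>

type_synonym joint_sample = "(nat \<Rightarrow> real) \<times> real"

definition joint_space :: "nat \<Rightarrow> joint_sample measure" where
  "joint_space n = (\<Pi>\<^sub>M i\<in>{1..n}. borel) \<Otimes>\<^sub>M borel"

definition joint_rv :: "nat \<Rightarrow> (nat \<Rightarrow> 'a \<Rightarrow> real) \<Rightarrow> ('a \<Rightarrow> real) \<Rightarrow> 'a \<Rightarrow> joint_sample" where
  "joint_rv n X fY \<omega> = (\<lambda>i\<in>{1..n}. X i \<omega>, fY \<omega>)"

definition iid_samples ::
  "'b measure \<Rightarrow> 'c measure \<Rightarrow> 'c measure \<Rightarrow> nat \<Rightarrow> (nat \<Rightarrow> 'b \<Rightarrow> 'c) \<Rightarrow> bool" where
  "iid_samples P N law k D \<longleftrightarrow>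
     prob_space.indep_vars P (\<lambda>_. N) D {..<k} \<and> (\<forall>l<k. distr P N (D l) = law)"

definition design_mat :: "nat set \<Rightarrow> nat \<Rightarrow> (nat \<Rightarrow> joint_sample) \<Rightarrow> real mat" where
  "design_mat S m d = mat_of_rows (card S + 1) (map (\<lambda>l. regressor S (fst (d l))) [0..<m])"

definition responses :: "nat \<Rightarrow> (nat \<Rightarrow> joint_sample) \<Rightarrow> real vec" where
  "responses m d = vec m (\<lambda>l. snd (d l))"

definition full_column_rank :: "real mat \<Rightarrow> bool" where
  "full_column_rank A \<longleftrightarrow> vec_space.rank (dim_row A) A = dim_col A"

text \<open>Singular matrices get the value \<open>0\<close>, so that the result has the right dimensions throughout.\<close>

definition inv_mat :: "real mat \<Rightarrow> real mat" where
  "inv_mat A = (case mat_inverse A of Some B \<Rightarrow> B | None \<Rightarrow> 0\<^sub>m (dim_row A) (dim_row A))"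

definition pseudo_inverse :: "real mat \<Rightarrow> real mat" where
  "pseudo_inverse Z = inv_mat (transpose_mat Z * Z) * transpose_mat Z"

definition beta_hat :: "nat set \<Rightarrow> nat \<Rightarrow> (nat \<Rightarrow> joint_sample) \<Rightarrow> real vec" where
  "beta_hat S m d = pseudo_inverse (design_mat S m d) *\<^sub>v responses m d"

section \<open>Exploitation\<close>

definition c_epr :: "(nat \<Rightarrow> real) \<Rightarrow> nat \<Rightarrow> real" where
  "c_epr c n = (\<Sum>i=0..n. c i)"

definition c_ept :: "(nat \<Rightarrow> real) \<Rightarrow> nat set \<Rightarrow> real" where
  "c_ept c S = (\<Sum>i\<in>S. c i)"

definition N_ept :: "(nat \<Rightarrow> real) \<Rightarrow> nat \<Rightarrow> nat set \<Rightarrow> nat \<Rightarrow> real \<Rightarrow> nat" where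
  "N_ept c n S m B = nat \<lfloor>(B - c_epr c n * real m) / c_ept c S\<rfloor>"

definition LRMC :: "nat \<Rightarrow> (nat \<Rightarrow> real vec) \<Rightarrow> real vec \<Rightarrow> real" where
  "LRMC N t b = (1 / real N) * (\<Sum>l<N. t l \<bullet> b)"

text \<open>
  The conditional mean squared error, given the estimated coefficients \<open>b\<close> (a random vector on
  \<open>P\<close>) and with exploitation samples \<open>T\<close>; \<open>\<mu>\<close> is the target value \<open>\<bbbE>[f(Y)]\<close>. The
  nonnegative version of the conditional expectation is used because the squared error need not
  be integrable over the exploration data.
\<close>

definition MSE_cond ::
  "'b measure \<Rightarrow> nat \<Rightarrow> nat \<Rightarrow> (nat \<Rightarrow> 'b \<Rightarrow> real vec) \<Rightarrow> ('b \<Rightarrow> real vec) \<Rightarrow> real \<Rightarrow> 'b \<Rightarrow> ennreal" where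
  "MSE_cond P k N T b \<mu> =
     nn_cond_exp P (vimage_algebra (space P) b (borel_vec k))
       (\<lambda>\<omega>. ennreal ((LRMC N (\<lambda>l. T l \<omega>) (b \<omega>) - \<mu>)\<^sup>2))"

text \<open>
  \<open>D\<close> are the \<open>m\<close> exploration samples and \<open>T\<close> the \<open>N\<close> exploitation samples, realised on some
  probability space \<open>P\<close>; only their joint distribution is prescribed by the model on \<open>M\<close>.
\<close>

definition sampling_scheme ::
  "'a measure \<Rightarrow> nat \<Rightarrow> (nat \<Rightarrow> 'a \<Rightarrow> real) \<Rightarrow> ('a \<Rightarrow> real) \<Rightarrow> nat set \<Rightarrow> nat \<Rightarrow> nat \<Rightarrow>
   'b measure \<Rightarrow> (nat \<Rightarrow> 'b \<Rightarrow> joint_sample) \<Rightarrow> (nat \<Rightarrow> 'b \<Rightarrow> real vec) \<Rightarrow> bool" where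
  "sampling_scheme M n X fY S m N P D T \<longleftrightarrow>
     prob_space P \<and>
     iid_samples P (joint_space n) (distr M (joint_space n) (joint_rv n X fY)) m D \<and>
     (AE \<omega> in P. full_column_rank (design_mat S m (\<lambda>l. D l \<omega>))) \<and>
     iid_samples P (borel_vec (card S + 1)) (distr M (borel_vec (card S + 1)) (XS X S)) N T \<and>
     indep_rv P
       (\<Pi>\<^sub>M l\<in>{..<m}. joint_space n) (\<lambda>\<omega>. \<lambda>l\<in>{..<m}. D l \<omega>)
       (\<Pi>\<^sub>M l\<in>{..<N}. borel_vec (card S + 1)) (\<lambda>\<omega>. \<lambda>l\<in>{..<N}. T l \<omega>)"

end

theory Submission
  imports Defs
begin

text \<open>
  Write \<open>\<delta>\<close> for the error of the estimated coefficients. Given the exploration data, the mean squared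
  error is \<open>Var(X \<bullet> b) / N\<close> plus the squared bias, hence at most
  \<open>2 Var(X \<bullet> \<beta>) / N + 2 \<bbbE>[(X \<bullet> \<delta>)\<^sup>2]\<close>. The normal equations say that the Gram matrix
  \<open>Z\<^sup>T Z / m\<close> maps \<open>\<delta>\<close> to \<open>Z\<^sup>T \<epsilon> / m\<close>. Except on an event of probability \<open>O(m\<^sup>-\<^sup>3)\<close> the Gram matrix is
  entrywise close to the invertible \<open>\<Lambda>\<close> (sixth moments), so \<open>\<delta>\<close> is controlled by
  \<open>Z\<^sup>T \<epsilon> / m\<close>. The latter is of order \<open>\<surd>(ln m / m)\<close> by a Chernoff bound for the exponential
  supermartingale \<open>exp (\<tau> \<Sum> x \<epsilon> - v \<tau>\<^sup>2 \<Sum> x\<^sup>2)\<close> with \<open>\<tau> = \<surd>(ln m / m)\<close>.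
\<close>

section \<open>Sums of independent variables\<close>

text \<open>Two features of the claim shape the estimates. The sub-Gaussian parameter
  \<open>v\<close> of the noise is not bounded by a universal multiple of \<sigma>^2, so the bound
  on the error of the coefficients comes out with a constant that depends on \<open>v\<close> and
  without the factor \<sigma>. The factor is put in by dividing the squared constant by \<sigma>^2,
  which is allowed because C may depend on the law; for \<sigma> = 0 the estimator is shown to be
  exact. Since C may depend on the dimension too, vectors are measured in the l1 norm and matrices
  entry by entry, without eigenvalues. The exponent 3 leaves room below the required m^-2: the
  number of bad events is fixed by the dimension, so the sum of their O(m^-3) probabilities drops
  below m^-2 once m exceeds a constant. The error is a conditional expectation given the estimator.
  It is evaluated by freezing the coefficients, which needs the estimator to be measurable, hence a
  formula for the matrix inverse that covers singular matrices.\<close>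

lemma (in prob_space)
  fixes W S :: "'a \<Rightarrow> real"
  assumes indep: "indep_var borel W borel S"
    and W: "\<And>q. q \<le> p \<Longrightarrow> integrable M (\<lambda>\<omega>. W \<omega> ^ q)"
    and S: "\<And>q. q \<le> p \<Longrightarrow> integrable M (\<lambda>\<omega>. S \<omega> ^ q)"
  shows integrable_power_add_indep: "integrable M (\<lambda>\<omega>. (W \<omega> + S \<omega>) ^ p)"
    and expectation_power_add_indep: "expectation (\<lambda>\<omega>. (W \<omega> + S \<omega>) ^ p) =
      (\<Sum>q\<le>p. real (p choose q) * expectation (\<lambda>\<omega>. W \<omega> ^ q) * expectation (\<lambda>\<omega>. S \<omega> ^ (p - q)))"
proof -
  have ind: "indep_var borel (\<lambda>\<omega>. W \<omega> ^ a) borel (\<lambda>\<omega>. S \<omega> ^ b)" for a b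
    using indep_var_compose[OF indep, of "\<lambda>x. x ^ a" borel "\<lambda>x. x ^ b" borel]
    by (simp add: comp_def)
  have int: "integrable M (\<lambda>\<omega>. W \<omega> ^ q * S \<omega> ^ (p - q))" if "q \<le> p" for q
    using that by (intro indep_var_integrable[OF ind] W S) auto
  have expand: "(W \<omega> + S \<omega>) ^ p = (\<Sum>q\<le>p. real (p choose q) * (W \<omega> ^ q * S \<omega> ^ (p - q)))" for \<omega>
    by (simp add: binomial_ring mult.assoc)
  show "integrable M (\<lambda>\<omega>. (W \<omega> + S \<omega>) ^ p)"
    unfolding expand using int by (intro Bochner_Integration.integrable_sum integrable_mult_right) auto
  have "expectation (\<lambda>\<omega>. (W \<omega> + S \<omega>) ^ p) =
      (\<Sum>q\<le>p. expectation (\<lambda>\<omega>. real (p choose q) * (W \<omega> ^ q * S \<omega> ^ (p - q))))"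
    unfolding expand using int by (intro Bochner_Integration.integral_sum integrable_mult_right) auto
  also have "\<dots> = (\<Sum>q\<le>p. real (p choose q) * expectation (\<lambda>\<omega>. W \<omega> ^ q) * expectation (\<lambda>\<omega>. S \<omega> ^ (p - q)))"
  proof (intro sum.cong refl)
    fix q assume "q \<in> {..p}"
    then have "expectation (\<lambda>\<omega>. W \<omega> ^ q * S \<omega> ^ (p - q)) =
        expectation (\<lambda>\<omega>. W \<omega> ^ q) * expectation (\<lambda>\<omega>. S \<omega> ^ (p - q))"
      by (intro indep_var_lebesgue_integral[OF ind] W S) auto
    then show "expectation (\<lambda>\<omega>. real (p choose q) * (W \<omega> ^ q * S \<omega> ^ (p - q))) =
        real (p choose q) * expectation (\<lambda>\<omega>. W \<omega> ^ q) * expectation (\<lambda>\<omega>. S \<omega> ^ (p - q))"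
      by simp
  qed
  finally show "expectation (\<lambda>\<omega>. (W \<omega> + S \<omega>) ^ p) =
      (\<Sum>q\<le>p. real (p choose q) * expectation (\<lambda>\<omega>. W \<omega> ^ q) * expectation (\<lambda>\<omega>. S \<omega> ^ (p - q)))" .
qed

text \<open>Induction on the number of summands, by the binomial expansion of the new summand plus
  the old sum. Both have mean zero, so every term with a first moment vanishes, and with it the
  fifth moments; the moments 2, 3, 4 and 6 then form a closed system of recursions. The sixth moment
  has order m^3 because its leading increment is 15 times a second moment times a fourth moment of
  order m^2.\<close>

lemma (in prob_space)
  fixes W :: "nat \<Rightarrow> 'a \<Rightarrow> real"
  assumes indep: "indep_vars (\<lambda>_. borel) W {..<m}"
    and int: "\<And>l q. l < m \<Longrightarrow> q \<le> 6 \<Longrightarrow> integrable M (\<lambda>\<omega>. W l \<omega> ^ q)"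
    and centered: "\<And>l. l < m \<Longrightarrow> expectation (W l) = 0"
    and bound: "\<And>l q. l < m \<Longrightarrow> q \<le> 6 \<Longrightarrow> \<bar>expectation (\<lambda>\<omega>. W l \<omega> ^ q)\<bar> \<le> c"
    and c: "c \<ge> 1"
  shows integrable_power_sum_indep: "q \<le> 6 \<Longrightarrow> integrable M (\<lambda>\<omega>. (\<Sum>l<m. W l \<omega>) ^ q)"
    and sixth_moment_sum_indep: "expectation (\<lambda>\<omega>. (\<Sum>l<m. W l \<omega>) ^ 6) \<le> 30 * c ^ 3 * real m ^ 3"
proof -
  have "(\<forall>q\<le>6. integrable M (\<lambda>\<omega>. (\<Sum>l<k. W l \<omega>) ^ q)) \<and>
      expectation (\<lambda>\<omega>. \<Sum>l<k. W l \<omega>) = 0 \<and>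
      \<bar>expectation (\<lambda>\<omega>. (\<Sum>l<k. W l \<omega>) ^ 2)\<bar> \<le> c * real k \<and>
      \<bar>expectation (\<lambda>\<omega>. (\<Sum>l<k. W l \<omega>) ^ 3)\<bar> \<le> c * real k \<and>
      \<bar>expectation (\<lambda>\<omega>. (\<Sum>l<k. W l \<omega>) ^ 4)\<bar> \<le> 6 * c ^ 2 * real k ^ 2 \<and>
      expectation (\<lambda>\<omega>. (\<Sum>l<k. W l \<omega>) ^ 6) \<le> 30 * c ^ 3 * real k ^ 3" if "k \<le> m" for k
    using that
  proof (induction k)
    case 0
    then show ?case by (auto simp: power_0_left)
  next
    case (Suc k)
    define S where "S \<omega> = (\<Sum>l<k. W l \<omega>)" for \<omega>
    define w where "w q = expectation (\<lambda>\<omega>. W k \<omega> ^ q)" for q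
    define s where "s q = expectation (\<lambda>\<omega>. S \<omega> ^ q)" for q
    from Suc have k: "k < m" by simp
    have "indep_vars (\<lambda>_. borel) W (insert k {..<k})"
      using k by (intro indep_vars_subset[OF indep]) auto
    then have ind: "indep_var borel (W k) borel S"
      unfolding S_def by (intro indep_vars_sum) auto
    have Sint: "integrable M (\<lambda>\<omega>. S \<omega> ^ q)" if "q \<le> 6" for q
      using Suc that unfolding S_def by simp
    have sum_eq: "(\<Sum>l<Suc k. W l \<omega>) = W k \<omega> + S \<omega>" for \<omega> by (simp add: S_def)
    have int': "integrable M (\<lambda>\<omega>. (W k \<omega> + S \<omega>) ^ q)" if "q \<le> 6" for q
      using that k by (intro integrable_power_add_indep[OF ind] int Sint) auto
    have exp: "expectation (\<lambda>\<omega>. (W k \<omega> + S \<omega>) ^ p) = (\<Sum>q\<le>p. real (p choose q) * w q * s (p - q))"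
      if "p \<le> 6" for p
      unfolding w_def s_def
      using that k by (intro expectation_power_add_indep[OF ind] int Sint) auto
    have w: "\<bar>w q\<bar> \<le> c" if "q \<le> 6" for q using bound[OF k that] by (simp add: w_def)
    have [simp]: "w 0 = 1" "s 0 = 1" by (simp_all add: w_def s_def prob_space)
    have w1 [simp]: "w (Suc 0) = 0" using centered[OF k] by (simp add: w_def)
    have s1 [simp]: "s (Suc 0) = 0" using Suc by (simp add: s_def S_def)
    have s2: "\<bar>s 2\<bar> \<le> c * real k" and s3: "\<bar>s 3\<bar> \<le> c * real k"
      and s4: "\<bar>s 4\<bar> \<le> 6 * c ^ 2 * real k ^ 2" and s6: "s 6 \<le> 30 * c ^ 3 * real k ^ 3"
      using Suc by (simp_all add: s_def S_def)
    have e2: "expectation (\<lambda>\<omega>. (W k \<omega> + S \<omega>) ^ 2) = s 2 + w 2"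
      by (subst exp) (simp_all add: eval_nat_numeral)
    have e3: "expectation (\<lambda>\<omega>. (W k \<omega> + S \<omega>) ^ 3) = s 3 + w 3"
      by (subst exp) (simp_all add: eval_nat_numeral)
    have e4: "expectation (\<lambda>\<omega>. (W k \<omega> + S \<omega>) ^ 4) = s 4 + 6 * w 2 * s 2 + w 4"
      by (subst exp) (simp_all add: eval_nat_numeral)
    have e6: "expectation (\<lambda>\<omega>. (W k \<omega> + S \<omega>) ^ 6) =
        s 6 + 15 * w 2 * s 4 + 20 * w 3 * s 3 + 15 * w 4 * s 2 + w 6"
      by (subst exp) (simp_all add: eval_nat_numeral)
    have c12: "c \<le> c ^ 2" "c ^ 2 \<le> c ^ 3" "c \<le> c ^ 3"
      using c power_increasing[of 1 2 c] power_increasing[of 2 3 c] power_increasing[of 1 3 c] by auto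
    have prod: "\<bar>w q * s r\<bar> \<le> c * b" if "q \<le> 6" "\<bar>s r\<bar> \<le> b" for q r b
      unfolding abs_mult using w[OF that(1)] that(2) c by (intro mult_mono) auto
    have w2s2: "\<bar>w 2 * s 2\<bar> \<le> c ^ 2 * real k"
      using prod[OF _ s2, of 2] by (simp add: power2_eq_square)
    have w4s2: "\<bar>w 4 * s 2\<bar> \<le> c ^ 2 * real k"
      using prod[OF _ s2, of 4] by (simp add: power2_eq_square)
    have w3s3: "\<bar>w 3 * s 3\<bar> \<le> c ^ 2 * real k"
      using prod[OF _ s3, of 3] by (simp add: power2_eq_square)
    have w2s4: "\<bar>w 2 * s 4\<bar> \<le> 6 * c ^ 3 * real k ^ 2"
      using prod[OF _ s4, of 2] by (simp add: power2_eq_square power3_eq_cube ac_simps)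
    have k1: "real (Suc k) ^ 2 = real k ^ 2 + 2 * real k + 1"
      "real (Suc k) ^ 3 = real k ^ 3 + 3 * real k ^ 2 + 3 * real k + 1"
      by (simp_all add: power2_eq_square power3_eq_cube algebra_simps)
    have "\<bar>s 4 + 6 * w 2 * s 2 + w 4\<bar> \<le> 6 * c ^ 2 * real k ^ 2 + 6 * (c ^ 2 * real k) + c ^ 2"
      using s4 w2s2 w[of 4] c12 by linarith
    also have "\<dots> \<le> 6 * c ^ 2 * real (Suc k) ^ 2"
      unfolding k1 distrib_left using c by simp
    finally have b4: "\<bar>s 4 + 6 * w 2 * s 2 + w 4\<bar> \<le> 6 * c ^ 2 * real (Suc k) ^ 2" .
    have ck: "c ^ 2 * real k \<le> c ^ 3 * real k"
      using c12 by (intro mult_right_mono) auto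
    \<comment> \<open>The constant 30 makes the quadratic terms match: the increment contributes 15
      * 6 = 90, and 30 times the growth 3 k^2 + 3 k + 1 of k^3 supplies 90 k^2. The linear terms fit
      because 35 is at most 90.\<close>
    have "s 6 + 15 * w 2 * s 4 + 20 * w 3 * s 3 + 15 * w 4 * s 2 + w 6 \<le>
        30 * c ^ 3 * real k ^ 3 + 15 * (6 * c ^ 3 * real k ^ 2) + 35 * (c ^ 3 * real k) + c ^ 3"
      using s6 w2s4 w3s3 w4s2 w[of 6] ck c12 by linarith
    also have "\<dots> \<le> 30 * c ^ 3 * real (Suc k) ^ 3"
      unfolding k1 distrib_left using c by simp
    finally have b6: "s 6 + 15 * w 2 * s 4 + 20 * w 3 * s 3 + 15 * w 4 * s 2 + w 6 \<le>
        30 * c ^ 3 * real (Suc k) ^ 3" .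
    have "expectation (\<lambda>\<omega>. W k \<omega> + S \<omega>) = 0"
      using int[OF k, of 1] Sint[of 1] w1 s1 by (simp add: w_def s_def)
    moreover have "\<bar>s 2 + w 2\<bar> \<le> c * real (Suc k)" "\<bar>s 3 + w 3\<bar> \<le> c * real (Suc k)"
      using s2 s3 w[of 2] w[of 3] by (simp_all add: distrib_left)
    ultimately show ?case
      unfolding sum_eq e2 e3 e4 e6 using int' b4 b6 by blast
  qed
  from this[of m] show "q \<le> 6 \<Longrightarrow> integrable M (\<lambda>\<omega>. (\<Sum>l<m. W l \<omega>) ^ q)"
    and "expectation (\<lambda>\<omega>. (\<Sum>l<m. W l \<omega>) ^ 6) \<le> 30 * c ^ 3 * real m ^ 3"
    by auto
qed

text \<open>Markov's inequality for the sixth power. The fourth power would give only a multiple of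
  m^-2 and leave no room for a union bound.\<close>

lemma (in prob_space) prob_sum_indep_ge_le:
  fixes W :: "nat \<Rightarrow> 'a \<Rightarrow> real"
  assumes indep: "indep_vars (\<lambda>_. borel) W {..<m}"
    and int: "\<And>l q. l < m \<Longrightarrow> q \<le> 6 \<Longrightarrow> integrable M (\<lambda>\<omega>. W l \<omega> ^ q)"
    and centered: "\<And>l. l < m \<Longrightarrow> expectation (W l) = 0"
    and bound: "\<And>l q. l < m \<Longrightarrow> q \<le> 6 \<Longrightarrow> \<bar>expectation (\<lambda>\<omega>. W l \<omega> ^ q)\<bar> \<le> c"
    and c: "c \<ge> 1" and \<eta>: "\<eta> > 0" and m: "m > 0"
  shows "prob {\<omega> \<in> space M. \<bar>\<Sum>l<m. W l \<omega>\<bar> \<ge> \<eta> * real m} \<le> 30 * c ^ 3 / \<eta> ^ 6 / real m ^ 3"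
proof -
  let ?S = "\<lambda>\<omega>. \<Sum>l<m. W l \<omega>"
  have rv: "W l \<in> borel_measurable M" if "l < m" for l
    using int[OF that, of 1] by auto
  have int6: "integrable M (\<lambda>\<omega>. ?S \<omega> ^ 6)"
    by (rule integrable_power_sum_indep[OF assms(1-5)]) auto
  have pos: "0 < (\<eta> * real m) ^ 6" using \<eta> m by simp
  have "prob {\<omega> \<in> space M. \<bar>?S \<omega>\<bar> \<ge> \<eta> * real m} \<le> prob {\<omega> \<in> space M. ?S \<omega> ^ 6 \<ge> (\<eta> * real m) ^ 6}"
  proof (rule finite_measure_mono)
    show "{\<omega> \<in> space M. \<bar>?S \<omega>\<bar> \<ge> \<eta> * real m} \<subseteq> {\<omega> \<in> space M. ?S \<omega> ^ 6 \<ge> (\<eta> * real m) ^ 6}"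
    proof safe
      fix \<omega> assume "\<eta> * real m \<le> \<bar>?S \<omega>\<bar>"
      then have "(\<eta> * real m) ^ 6 \<le> \<bar>?S \<omega>\<bar> ^ 6" using \<eta> by (intro power_mono) auto
      then show "(\<eta> * real m) ^ 6 \<le> ?S \<omega> ^ 6" by (simp add: power_even_abs)
    qed
    have [measurable]: "?S \<in> borel_measurable M" using rv by (intro borel_measurable_sum) auto
    show "{\<omega> \<in> space M. ?S \<omega> ^ 6 \<ge> (\<eta> * real m) ^ 6} \<in> events" by measurable
  qed
  also have "\<dots> \<le> expectation (\<lambda>\<omega>. ?S \<omega> ^ 6) / (\<eta> * real m) ^ 6"
    using integral_Markov_inequality_measure[OF int6, of "{}" "(\<eta> * real m) ^ 6"] pos
    by (simp add: zero_le_even_power)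
  also have "\<dots> \<le> (30 * c ^ 3 * real m ^ 3) / (\<eta> * real m) ^ 6"
    using sixth_moment_sum_indep[OF assms(1-5)] pos by (intro divide_right_mono) auto
  also have "\<dots> = 30 * c ^ 3 / \<eta> ^ 6 / real m ^ 3"
    using m \<eta> by (simp add: field_simps flip: power_add)
  finally show ?thesis .
qed

section \<open>Exponential moments of sub-Gaussian variables\<close>

lemma exp_le_add_exp_square: "exp x \<le> x + exp (x\<^sup>2)" for x :: real
proof -
  \<comment> \<open>Up to x = 1 the stronger bound 1 + x + x^2 is available; beyond 1, x is at most
    x^2 and the linear term is a bonus.\<close>
  have quad: "exp x \<le> x + exp (x\<^sup>2)" if "exp x \<le> 1 + x + x\<^sup>2"
    using that exp_ge_add_one_self[of "x\<^sup>2"] by linarith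
  consider "x < 0" | "0 \<le> x" "x \<le> 1" | "x > 1" by linarith
  then show ?thesis
  proof cases
    case 1
    have "1 \<le> 1 + (- x) ^ 3" using 1 by simp
    also have "\<dots> = (1 + x + x\<^sup>2) * (1 - x)" by (simp add: power2_eq_square power3_eq_cube algebra_simps)
    also have "\<dots> \<le> (1 + x + x\<^sup>2) * exp (- x)"
      using exp_ge_add_one_self[of "- x"] zero_le_power2[of "x + 1 / 2"]
      by (intro mult_left_mono) (auto simp: power2_eq_square algebra_simps)
    finally show ?thesis by (intro quad) (simp add: exp_minus field_simps)
  next
    case 2
    then show ?thesis by (intro quad exp_bound) auto
  next
    case 3
    then have "x \<le> x\<^sup>2" by (simp add: power2_eq_square)
    then have "exp x \<le> exp (x\<^sup>2)" by simp
    then show ?thesis using 3 by linarith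
  qed
qed

text \<open>Keeping the linear term in \<open>exp_le_add_exp_square\<close> is what exploits the
  centering: it integrates to zero, and only a term of second order in \<open>s\<close> remains.
  This works while a = C^2 s^2 is at most 1; for larger a a crude bound is enough, since exp (2 a)
  is then already large.\<close>

lemma (in prob_space) nn_integral_exp_le_of_exp_square:
  fixes W :: "'a \<Rightarrow> real"
  assumes [measurable]: "W \<in> borel_measurable M"
    and C: "C > 0" and Y: "(\<integral>\<^sup>+\<omega>. ennreal (exp ((W \<omega>)\<^sup>2 / C\<^sup>2)) \<partial>M) \<le> 2"
    and centered: "expectation W = 0"
  shows "integrable M (\<lambda>\<omega>. (W \<omega>)\<^sup>2)" and "integrable M W"
    and "(\<integral>\<^sup>+\<omega>. ennreal (exp (s * W \<omega>)) \<partial>M) \<le> ennreal (exp (2 * C\<^sup>2 * s\<^sup>2))"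
proof -
  define Y where "Y \<omega> = exp ((W \<omega>)\<^sup>2 / C\<^sup>2)" for \<omega>
  have [measurable]: "Y \<in> borel_measurable M" unfolding Y_def by measurable
  have Y1: "1 \<le> Y \<omega>" for \<omega> by (simp add: Y_def)
  have Yn: "(\<integral>\<^sup>+\<omega>. ennreal (Y \<omega>) \<partial>M) \<le> 2" using Y by (simp add: Y_def)
  have Yint: "integrable M Y"
    using Yn Y1 order_trans[OF zero_le_one Y1]
    by (intro integrableI_nonneg) (auto intro: le_less_trans)
  have EY: "expectation Y \<le> 2"
  proof -
    have "ennreal (expectation Y) \<le> ennreal 2"
      using Yn nn_integral_eq_integral[OF Yint] order_trans[OF zero_le_one Y1] by simp
    then show ?thesis by (subst (asm) ennreal_le_iff) auto
  qed
  have W2: "(W \<omega>)\<^sup>2 \<le> C\<^sup>2 * Y \<omega>" for \<omega>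
  proof -
    have "(W \<omega>)\<^sup>2 / C\<^sup>2 \<le> Y \<omega>"
      unfolding Y_def using exp_ge_add_one_self[of "(W \<omega>)\<^sup>2 / C\<^sup>2"] by linarith
    then show ?thesis using C by (simp add: field_simps)
  qed
  show int2: "integrable M (\<lambda>\<omega>. (W \<omega>)\<^sup>2)"
    by (rule Bochner_Integration.integrable_bound[OF integrable_mult_right[OF Yint, of "C\<^sup>2"]])
       (use W2 in \<open>auto intro: order_trans[OF _ abs_ge_self]\<close>)
  have W1: "\<bar>W \<omega>\<bar> \<le> 1 + (W \<omega>)\<^sup>2" for \<omega>
    using zero_le_power2[of "\<bar>W \<omega>\<bar> - 1/2"] by (simp add: power2_eq_square algebra_simps abs_mult_self_eq)
  show int1: "integrable M W"
    by (rule Bochner_Integration.integrable_bound[of _ "\<lambda>\<omega>. 1 + (W \<omega>)\<^sup>2"])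
       (use int2 W1 in \<open>auto intro: order_trans[OF _ abs_ge_self]\<close>)
  define a where "a = C\<^sup>2 * s\<^sup>2"
  have a0: "a \<ge> 0" by (simp add: a_def)
  show "(\<integral>\<^sup>+\<omega>. ennreal (exp (s * W \<omega>)) \<partial>M) \<le> ennreal (exp (2 * C\<^sup>2 * s\<^sup>2))"
  proof (cases "a \<le> 1")
    case True
    \<comment> \<open>The exponent (s W)^2 equals a times W^2 / C^2, so convexity of exp between 0
      and W^2 / C^2 bounds its exponential by (1 - a) + a Y. With E Y at most 2 the right-hand side
      integrates to at most 1 + a.\<close>
    have le: "exp (s * W \<omega>) \<le> s * W \<omega> + (1 - a) + a * Y \<omega>" for \<omega>
    proof -
      have "exp ((1 - a) *\<^sub>R 0 + a *\<^sub>R ((W \<omega>)\<^sup>2 / C\<^sup>2)) \<le> (1 - a) * exp 0 + a * Y \<omega>"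
        unfolding Y_def using True a0 by (intro convex_onD[OF exp_convex]) auto
      then have "exp ((s * W \<omega>)\<^sup>2) \<le> (1 - a) + a * Y \<omega>"
        using C by (simp add: a_def power_mult_distrib)
      then show ?thesis using exp_le_add_exp_square[of "s * W \<omega>"] by linarith
    qed
    have rint: "integrable M (\<lambda>\<omega>. s * W \<omega> + (1 - a) + a * Y \<omega>)" using int1 Yint by auto
    have "(\<integral>\<^sup>+\<omega>. ennreal (exp (s * W \<omega>)) \<partial>M) \<le> (\<integral>\<^sup>+\<omega>. ennreal (s * W \<omega> + (1 - a) + a * Y \<omega>) \<partial>M)"
      using le by (intro nn_integral_mono ennreal_leI)
    also have "\<dots> = ennreal (expectation (\<lambda>\<omega>. s * W \<omega> + (1 - a) + a * Y \<omega>))"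
      using le order_trans[OF less_imp_le[OF exp_gt_zero] le]
      by (intro nn_integral_eq_integral[OF rint]) auto
    also have "expectation (\<lambda>\<omega>. s * W \<omega> + (1 - a) + a * Y \<omega>) = 1 - a + a * expectation Y"
      using int1 Yint centered by (simp add: prob_space)
    also have "\<dots> \<le> 1 + a" using mult_left_mono[OF EY a0] by simp
    also have "\<dots> \<le> exp (2 * a)"
      using exp_ge_add_one_self[of "2 * a"] a0 by linarith
    also have "\<dots> = exp (2 * C\<^sup>2 * s\<^sup>2)" by (simp add: a_def mult.assoc)
    finally show ?thesis by (simp add: ennreal_leI)
  next
    case False
    \<comment> \<open>Completing the square separates s from W. The factor 2 from E Y is absorbed
      because 2 <= exp (3 a / 2) for a > 1.\<close>
    have le: "exp (s * W \<omega>) \<le> exp (a / 2) * Y \<omega>" for \<omega>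
    proof -
      have "0 \<le> (s * C - W \<omega> / C)\<^sup>2" by simp
      also have "\<dots> = a - 2 * s * W \<omega> + (W \<omega>)\<^sup>2 / C\<^sup>2"
        using C by (simp add: a_def power2_eq_square field_simps)
      finally have "2 * (s * W \<omega>) \<le> a + (W \<omega>)\<^sup>2 / C\<^sup>2" by simp
      moreover have "0 \<le> (W \<omega>)\<^sup>2 / C\<^sup>2" by simp
      ultimately have "s * W \<omega> \<le> a / 2 + (W \<omega>)\<^sup>2 / C\<^sup>2" by linarith
      then show ?thesis by (simp add: Y_def flip: exp_add)
    qed
    have "(\<integral>\<^sup>+\<omega>. ennreal (exp (s * W \<omega>)) \<partial>M) \<le> (\<integral>\<^sup>+\<omega>. ennreal (exp (a / 2)) * ennreal (Y \<omega>) \<partial>M)"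
      using le order_trans[OF zero_le_one Y1]
      by (intro nn_integral_mono) (auto intro: ennreal_leI simp flip: ennreal_mult)
    also have "\<dots> \<le> ennreal (exp (a / 2)) * 2"
      using Yn by (subst nn_integral_cmult) (auto intro: mult_left_mono)
    also have "\<dots> = ennreal (exp (a / 2) * 2)" by (simp add: ennreal_mult)
    also have "exp (a / 2) * 2 \<le> exp (a / 2) * exp (3 * a / 2)"
    proof (intro mult_left_mono)
      show "2 \<le> exp (3 * a / 2)" using exp_ge_add_one_self[of "3 * a / 2"] False by linarith
    qed auto
    also have "\<dots> = exp (2 * C\<^sup>2 * s\<^sup>2)" by (simp add: a_def mult.assoc flip: exp_add)
    finally show ?thesis by (simp add: ennreal_leI)
  qed
qed

text \<open>Markov's inequality for the exponential of the sum, whose integral factorises by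
  independence. Working with nonnegative integrals makes integrability a non-issue.\<close>

lemma (in prob_space) indep_vars_chernoff:
  fixes V :: "nat \<Rightarrow> 'a \<Rightarrow> real"
  assumes indep: "indep_vars (\<lambda>_. borel) V {..<m}"
    and V: "\<And>l. l < m \<Longrightarrow> (\<integral>\<^sup>+\<omega>. ennreal (exp (V l \<omega>)) \<partial>M) \<le> 1"
  shows "prob {\<omega> \<in> space M. (\<Sum>l<m. V l \<omega>) \<ge> t} \<le> exp (- t)"
proof -
  have rv: "V l \<in> borel_measurable M" if "l < m" for l
    using indep that by (auto simp: indep_vars_def)
  have [measurable]: "(\<lambda>\<omega>. \<Sum>l<m. V l \<omega>) \<in> borel_measurable M"
    using rv by (intro borel_measurable_sum) auto
  have "(\<integral>\<^sup>+\<omega>. ennreal (exp (\<Sum>l<m. V l \<omega>)) \<partial>M) = (\<integral>\<^sup>+\<omega>. (\<Prod>l<m. ennreal (exp (V l \<omega>))) \<partial>M)"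
    by (simp add: exp_sum prod_ennreal)
  also have "\<dots> = (\<Prod>l<m. \<integral>\<^sup>+\<omega>. ennreal (exp (V l \<omega>)) \<partial>M)"
    by (intro indep_vars_nn_integral indep_vars_compose2[OF indep]) auto
  also have "\<dots> \<le> (\<Prod>l<m. 1)" using V by (intro prod_mono_ennreal) auto
  finally have le1: "(\<integral>\<^sup>+\<omega>. ennreal (exp (\<Sum>l<m. V l \<omega>)) \<partial>M) \<le> 1" by simp
  have "emeasure M {\<omega> \<in> space M. (\<Sum>l<m. V l \<omega>) \<ge> t} =
      emeasure M {\<omega> \<in> space M. 1 \<le> ennreal (exp (- t)) * ennreal (exp (\<Sum>l<m. V l \<omega>))}"
    by (intro arg_cong[where f = "emeasure M"] Collect_cong conj_cong refl)
       (simp add: ennreal_mult[symmetric] exp_add[symmetric] flip: ennreal_1)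
  also have "\<dots> \<le> ennreal (exp (- t)) * (\<integral>\<^sup>+\<omega>. ennreal (exp (\<Sum>l<m. V l \<omega>)) * indicator (space M) \<omega> \<partial>M)"
    using nn_integral_Markov_inequality[of "\<lambda>\<omega>. ennreal (exp (\<Sum>l<m. V l \<omega>))" "space M" M "ennreal (exp (- t))"]
    by simp
  also have "\<dots> \<le> ennreal (exp (- t)) * 1"
    using le1 by (intro mult_left_mono) (auto cong: nn_integral_cong)
  finally show ?thesis by (simp add: emeasure_eq_measure)
qed

section \<open>Product laws and Fubini for independent variables of different types\<close>

lemma indep_rv_commute: "prob_space M \<Longrightarrow> indep_rv M MU U MV V \<Longrightarrow> indep_rv M MV V MU U"
  by (auto simp: indep_rv_def prob_space.indep_sets2_eq) (metis Int_commute mult.commute)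

lemma distr_pair_indep_rv:
  assumes "prob_space M" and indep: "indep_rv M MU U MV V"
  shows "distr M MU U \<Otimes>\<^sub>M distr M MV V = distr M (MU \<Otimes>\<^sub>M MV) (\<lambda>\<omega>. (U \<omega>, V \<omega>))"
proof -
  interpret prob_space M by fact
  from indep have [measurable]: "U \<in> measurable M MU" "V \<in> measurable M MV"
    and ind: "indep_set (sets (vimage_algebra (space M) U MU)) (sets (vimage_algebra (space M) V MV))"
    by (auto simp: indep_rv_def)
  interpret U: prob_space "distr M MU U" by (rule prob_space_distr) fact
  interpret V: prob_space "distr M MV V" by (rule prob_space_distr) fact
  show ?thesis
  proof (rule pair_measure_eqI)
    fix A B assume "A \<in> sets (distr M MU U)" "B \<in> sets (distr M MV V)"
    then have [measurable]: "A \<in> sets MU" "B \<in> sets MV" by auto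
    have "prob ((U -` A \<inter> space M) \<inter> (V -` B \<inter> space M)) = prob (U -` A \<inter> space M) * prob (V -` B \<inter> space M)"
      by (rule indep_setD[OF ind]) (auto intro: in_vimage_algebra)
    moreover have "(\<lambda>\<omega>. (U \<omega>, V \<omega>)) -` (A \<times> B) \<inter> space M = (U -` A \<inter> space M) \<inter> (V -` B \<inter> space M)"
      by auto
    ultimately show "emeasure (distr M MU U) A * emeasure (distr M MV V) B =
        emeasure (distr M (MU \<Otimes>\<^sub>M MV) (\<lambda>\<omega>. (U \<omega>, V \<omega>))) (A \<times> B)"
      by (simp add: emeasure_distr emeasure_eq_measure ennreal_mult)
  qed (auto simp: U.sigma_finite_measure_axioms V.sigma_finite_measure_axioms
        intro!: U.sigma_finite_measure V.sigma_finite_measure cong: sets_pair_measure_cong)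
qed

text \<open>Fubini for the product law, with the second variable replaced by an independent copy. It
  serves twice: to integrate out the noise with the regressor held fixed, and to freeze the
  exploration data in the conditional error.\<close>

lemma nn_integral_indep_rv:
  assumes "prob_space M" and indep: "indep_rv M MU U MV V"
    and f [measurable]: "f \<in> borel_measurable (MU \<Otimes>\<^sub>M MV)"
  shows "(\<integral>\<^sup>+\<omega>. f (U \<omega>, V \<omega>) \<partial>M) = (\<integral>\<^sup>+\<omega>. (\<integral>\<^sup>+\<omega>'. f (U \<omega>, V \<omega>') \<partial>M) \<partial>M)"
proof -
  interpret prob_space M by fact
  from indep have [measurable]: "U \<in> measurable M MU" "V \<in> measurable M MV"
    by (auto simp: indep_rv_def)
  interpret V: prob_space "distr M MV V" by (rule prob_space_distr) fact
  have *: "(\<integral>\<^sup>+v. f (u, v) \<partial>distr M MV V) = (\<integral>\<^sup>+\<omega>. f (u, V \<omega>) \<partial>M)" if "u \<in> space MU" for u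
    using that by (intro nn_integral_distr) measurable
  have f': "f \<in> borel_measurable (MU \<Otimes>\<^sub>M distr M MV V)"
    by (subst measurable_cong_sets[OF sets_pair_measure_cong[OF refl sets_distr] refl]) fact
  have m: "(\<lambda>u. \<integral>\<^sup>+v. f (u, v) \<partial>distr M MV V) \<in> borel_measurable MU"
    using V.borel_measurable_nn_integral_fst[OF f'] .
  have "(\<integral>\<^sup>+\<omega>. f (U \<omega>, V \<omega>) \<partial>M) = (\<integral>\<^sup>+p. f p \<partial>(distr M MU U \<Otimes>\<^sub>M distr M MV V))"
    unfolding distr_pair_indep_rv[OF assms(1,2)] by (subst nn_integral_distr) auto
  also have "\<dots> = (\<integral>\<^sup>+u. (\<integral>\<^sup>+v. f (u, v) \<partial>distr M MV V) \<partial>distr M MU U)"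
    by (rule V.nn_integral_fst[symmetric])
       (subst measurable_cong_sets[OF sets_pair_measure_cong[OF sets_distr sets_distr] refl], fact)
  also have "\<dots> = (\<integral>\<^sup>+\<omega>. (\<integral>\<^sup>+v. f (U \<omega>, v) \<partial>distr M MV V) \<partial>M)"
    using m by (intro nn_integral_distr) auto
  also have "\<dots> = (\<integral>\<^sup>+\<omega>. (\<integral>\<^sup>+\<omega>'. f (U \<omega>, V \<omega>') \<partial>M) \<partial>M)"
    by (intro nn_integral_cong *) (auto dest: measurable_space[OF \<open>U \<in> measurable M MU\<close>])
  finally show ?thesis .
qed

section \<open>Measurability of the least squares estimator\<close>

lemma measurable_borel_vecI:
  assumes "\<And>x. x \<in> space N \<Longrightarrow> f x \<in> carrier_vec k"
    and "\<And>i. i < k \<Longrightarrow> (\<lambda>x. f x $ i) \<in> borel_measurable N"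
  shows "f \<in> measurable N (borel_vec k)"
  unfolding borel_vec_def
  using assms by (intro measurable_vimage_algebra2 measurable_restrict) auto

lemma space_borel_vec [simp]: "space (borel_vec k) = carrier_vec k"
  by (simp add: borel_vec_def)

lemma borel_measurable_vec_index:
  assumes "f \<in> measurable N (borel_vec k)" and "i < k"
  shows "(\<lambda>x. f x $ i) \<in> borel_measurable N"
proof -
  let ?r = "\<lambda>v. \<lambda>i\<in>{..<k}. v $ i"
  have "?r \<in> measurable (borel_vec k) (\<Pi>\<^sub>M i\<in>{..<k}. (borel :: real measure))"
    unfolding borel_vec_def by (intro measurable_vimage_algebra1) (auto simp: space_PiM)
  from measurable_compose[OF this measurable_component_singleton, of i] assms(2)
  have "(\<lambda>v. ?r v i) \<in> borel_measurable (borel_vec k)" by simp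
  then have "(\<lambda>v. v $ i) \<in> borel_measurable (borel_vec k)"
    using assms(2) by simp
  from measurable_compose[OF assms(1) this] show ?thesis .
qed

lemma borel_measurable_scalar_prod:
  assumes "\<And>x. x \<in> space N \<Longrightarrow> g x \<in> carrier_vec k"
    and "\<And>i. i < k \<Longrightarrow> (\<lambda>x. f x $ i) \<in> borel_measurable N"
    and "\<And>i. i < k \<Longrightarrow> (\<lambda>x. g x $ i :: real) \<in> borel_measurable N"
  shows "(\<lambda>x. f x \<bullet> g x) \<in> borel_measurable N"
proof -
  have "(\<lambda>x. \<Sum>i<k. f x $ i * g x $ i) \<in> borel_measurable N"
    using assms by (intro borel_measurable_sum borel_measurable_times) auto
  then show ?thesis
    using assms(1) by (subst measurable_cong[where g = "\<lambda>x. \<Sum>i<k. f x $ i * g x $ i"])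
      (auto simp: scalar_prod_def atLeast0LessThan dest!: carrier_vecD)
qed

lemma borel_measurable_mult_mat:
  assumes "\<And>x. F x \<in> carrier_mat r c" and "\<And>x. G x \<in> carrier_mat c q"
    and "\<And>i j. i < r \<Longrightarrow> j < c \<Longrightarrow> (\<lambda>x. F x $$ (i, j) :: real) \<in> borel_measurable N"
    and "\<And>i j. i < c \<Longrightarrow> j < q \<Longrightarrow> (\<lambda>x. G x $$ (i, j)) \<in> borel_measurable N"
    and "i < r" and "j < q"
  shows "(\<lambda>x. (F x * G x) $$ (i, j)) \<in> borel_measurable N"
proof -
  have "(F x * G x) $$ (i, j) = (\<Sum>l<c. F x $$ (i, l) * G x $$ (l, j))" for x
    using assms(1,2)[of x] assms(5,6) by (auto simp: scalar_prod_def atLeast0LessThan)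
  then show ?thesis
    using assms(3-6) by (simp only:) (intro borel_measurable_sum borel_measurable_times; auto)
qed

text \<open>By the Leibniz formula the determinant is a polynomial in the entries.\<close>

lemma borel_measurable_det:
  assumes "\<And>x. F x \<in> carrier_mat k k"
    and "\<And>i j. i < k \<Longrightarrow> j < k \<Longrightarrow> (\<lambda>x. F x $$ (i, j) :: real) \<in> borel_measurable N"
  shows "(\<lambda>x. det (F x)) \<in> borel_measurable N"
  unfolding det_def'[OF assms(1)]
proof (intro borel_measurable_sum borel_measurable_times borel_measurable_prod borel_measurable_const)
  fix p i assume "p \<in> {p. p permutes {0..<k}}" "i \<in> {0..<k}"
  then have "i < k" "p i < k" using permutes_in_image[of p "{0..<k}" i] by auto
  then show "(\<lambda>x. F x $$ (i, p i)) \<in> borel_measurable N" by (rule assms(2))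
qed

text \<open>Cramer's rule, including the default value: \<open>mat_inverse\<close> fails exactly
  when the determinant vanishes. It replaces an inverse computed by elimination with an explicit
  expression in the entries, from which measurability can be read off.\<close>

lemma inv_mat_eq_adj_mat:
  fixes A :: "real mat"
  assumes A: "A \<in> carrier_mat k k"
  shows "inv_mat A = (if det A = 0 then 0\<^sub>m k k else (1 / det A) \<cdot>\<^sub>m adj_mat A)"
proof (cases "mat_inverse A")
  case None
  have "det A = 0"
    using mat_inverse(1)[OF A None, of "()"] det_non_zero_imp_unit[OF A, of "()"] by blast
  then show ?thesis using None A by (simp add: inv_mat_def)
next
  case (Some B)
  from mat_inverse(2)[OF A Some] have B: "A * B = 1\<^sub>m k" "B * A = 1\<^sub>m k" "B \<in> carrier_mat k k"
    by auto
  have "det A * det B = 1" using det_mult[OF A B(3)] B(1) by simp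
  then have "det A \<noteq> 0" by auto
  have adj: "adj_mat A \<in> carrier_mat k k" by (rule adj_mat(1)[OF A])
  have "adj_mat A = (B * A) * adj_mat A" using B adj by simp
  also have "\<dots> = B * (A * adj_mat A)" using A B adj by (intro assoc_mult_mat) auto
  also have "\<dots> = det A \<cdot>\<^sub>m B"
    using adj_mat(2)[OF A] B mult_smult_distrib[OF B(3) one_carrier_mat, of "det A"] by simp
  finally have "(1 / det A) \<cdot>\<^sub>m adj_mat A = B"
    using \<open>det A \<noteq> 0\<close> B by (intro eq_matI) auto
  then show ?thesis using Some \<open>det A \<noteq> 0\<close> by (simp add: inv_mat_def)
qed

lemma borel_measurable_inv_mat:
  assumes F: "\<And>x. F x \<in> carrier_mat k k"
    and mF: "\<And>i j. i < k \<Longrightarrow> j < k \<Longrightarrow> (\<lambda>x. F x $$ (i, j) :: real) \<in> borel_measurable N"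
    and ij: "i < k" "j < k"
  shows "(\<lambda>x. inv_mat (F x) $$ (i, j)) \<in> borel_measurable N"
proof -
  have [measurable]: "(\<lambda>x. det (F x)) \<in> borel_measurable N"
    by (rule borel_measurable_det[OF F mF])
  have "(\<lambda>x. det (mat_delete (F x) j i)) \<in> borel_measurable N"
  proof (rule borel_measurable_det)
    show "mat_delete (F x) j i \<in> carrier_mat (k - 1) (k - 1)" for x
      using F[of x] by (auto simp: mat_delete_def)
    fix i' j' assume "i' < k - 1" "j' < k - 1"
    then have "mat_delete (F x) j i $$ (i', j') =
        F x $$ (if i' < j then i' else Suc i', if j' < i then j' else Suc j')" for x
      using F[of x] by (auto simp: mat_delete_def)
    then show "(\<lambda>x. mat_delete (F x) j i $$ (i', j')) \<in> borel_measurable N"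
      using \<open>i' < k - 1\<close> \<open>j' < k - 1\<close> mF by simp
  qed
  then have [measurable]: "(\<lambda>x. cofactor (F x) j i) \<in> borel_measurable N"
    unfolding cofactor_def by measurable
  have "inv_mat (F x) $$ (i, j) = (if det (F x) = 0 then 0 else 1 / det (F x) * cofactor (F x) j i)" for x
    using F[of x] ij by (simp add: inv_mat_eq_adj_mat[OF F] adj_mat_def)
  then show ?thesis by simp
qed

lemma inv_mat_carrier:
  assumes "A \<in> carrier_mat k k"
  shows "inv_mat A \<in> carrier_mat k k"
  using assms adj_mat(1)[OF assms] by (simp add: inv_mat_eq_adj_mat[OF assms])

lemma design_mat_carrier: "design_mat S m d \<in> carrier_mat m (card S + 1)"
  using mat_of_rows_carrier(1)[of "card S + 1" "map (\<lambda>l. regressor S (fst (d l))) [0..<m]"]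
  unfolding design_mat_def length_map length_upt diff_zero .

lemma regressor_carrier: "regressor S x \<in> carrier_vec (card S + 1)"
  unfolding regressor_def by (rule vec_carrier)

lemma design_mat_index:
  assumes "l < m" and "j < card S + 1"
  shows "design_mat S m d $$ (l, j) = regressor S (fst (d l)) $ j"
  unfolding design_mat_def using assms by (subst mat_of_rows_index) simp_all

lemma borel_measurable_regressor_index:
  assumes S: "S \<subseteq> {1..n}" and j: "j < card S + 1"
    and x: "\<And>i. i \<in> {1..n} \<Longrightarrow> (\<lambda>\<omega>. x \<omega> i) \<in> borel_measurable N"
  shows "(\<lambda>\<omega>. regressor S (x \<omega>) $ j) \<in> borel_measurable N"
proof (cases "j = 0")
  case True
  then show ?thesis by (simp add: regressor_def)
next
  case False
  have "finite S" using S finite_subset by blast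
  then have "sorted_list_of_set S ! (j - 1) \<in> S"
    using False j nth_mem[of "j - 1" "sorted_list_of_set S"] by simp
  then have "(\<lambda>\<omega>. x \<omega> (sorted_list_of_set S ! (j - 1))) \<in> borel_measurable N"
    using S by (intro x) blast
  then show ?thesis using False j by (simp add: regressor_def)
qed

lemma measurable_regressor_joint_space:
  assumes "S \<subseteq> {1..n}" and "d \<in> measurable N (joint_space n)"
  shows "(\<lambda>\<omega>. regressor S (fst (d \<omega>))) \<in> measurable N (borel_vec (card S + 1))"
proof (rule measurable_borel_vecI)
  have "(\<lambda>\<omega>. fst (d \<omega>)) \<in> measurable N (\<Pi>\<^sub>M i\<in>{1..n}. borel)"
    by (rule measurable_compose[OF assms(2)[unfolded joint_space_def] measurable_fst])
  note * = measurable_compose[OF this measurable_component_singleton]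
  have "(\<lambda>\<omega>. fst (d \<omega>) i) \<in> borel_measurable N" if "i \<in> {1..n}" for i
    by (rule *[OF that])
  then show "(\<lambda>\<omega>. regressor S (fst (d \<omega>)) $ j) \<in> borel_measurable N" if "j < card S + 1" for j
    by (rule borel_measurable_regressor_index[OF assms(1) that])
qed (rule regressor_carrier)

text \<open>The conditioning in \<open>MSE_cond\<close> is on the sigma-algebra generated by the
  estimator; writing the estimator as a measurable function of the exploration data is what makes
  the freezing argument applicable.\<close>

lemma measurable_beta_hat:
  assumes S: "S \<subseteq> {1..n}"
  shows "beta_hat S m \<in> measurable (\<Pi>\<^sub>M l\<in>{..<m}. joint_space n) (borel_vec (card S + 1))"
proof -
  define k where "k = card S + 1"
  define N where "N = (\<Pi>\<^sub>M l\<in>{..<m}. joint_space n)"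
  define Z where "Z = design_mat S m"
  define ZT where "ZT d = transpose_mat (Z d)" for d
  define A where "A d = ZT d * Z d" for d
  define B where "B d = inv_mat (A d)" for d
  define Q where "Q d = B d * ZT d" for d
  have comp: "(\<lambda>d. d l) \<in> measurable N (joint_space n)" if "l < m" for l
    unfolding N_def using that by (intro measurable_component_singleton) auto
  have Zc: "Z d \<in> carrier_mat m k" for d
    unfolding Z_def k_def by (rule design_mat_carrier)
  then have ZTc: "ZT d \<in> carrier_mat k m" for d by (simp add: ZT_def)
  have Ac: "A d \<in> carrier_mat k k" for d unfolding A_def by (rule mult_carrier_mat[OF ZTc Zc])
  then have Bc: "B d \<in> carrier_mat k k" for d unfolding B_def by (rule inv_mat_carrier)
  have Qc: "Q d \<in> carrier_mat k m" for d unfolding Q_def by (rule mult_carrier_mat[OF Bc ZTc])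
  have mZ: "(\<lambda>d. Z d $$ (l, j)) \<in> borel_measurable N" if "l < m" "j < k" for l j
  proof -
    have "(\<lambda>d. regressor S (fst (d l)) $ j) \<in> borel_measurable N"
      using that(2) unfolding k_def
      by (rule borel_measurable_vec_index[OF measurable_regressor_joint_space[OF S comp[OF that(1)]]])
    then show ?thesis using that unfolding Z_def k_def by (simp add: design_mat_index)
  qed
  have mZT: "(\<lambda>d. ZT d $$ (j, l)) \<in> borel_measurable N" if "j < k" "l < m" for j l
  proof -
    have "ZT d $$ (j, l) = Z d $$ (l, j)" for d using Zc[of d] that by (simp add: ZT_def)
    then show ?thesis using mZ[OF that(2,1)] by simp
  qed
  have mA: "(\<lambda>d. A d $$ (i, j)) \<in> borel_measurable N" if "i < k" "j < k" for i j
    unfolding A_def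
    by (rule borel_measurable_mult_mat[where F = ZT and G = Z, OF ZTc Zc]) (auto intro: that mZT mZ)
  have mB: "(\<lambda>d. B d $$ (i, j)) \<in> borel_measurable N" if "i < k" "j < k" for i j
    unfolding B_def by (rule borel_measurable_inv_mat[where F = A, OF Ac]) (auto intro: that mA)
  have mQ: "(\<lambda>d. Q d $$ (i, l)) \<in> borel_measurable N" if "i < k" "l < m" for i l
    unfolding Q_def
    by (rule borel_measurable_mult_mat[where F = B and G = ZT, OF Bc ZTc]) (auto intro: that mB mZT)
  have b: "beta_hat S m d = Q d *\<^sub>v responses m d" for d
    by (simp add: beta_hat_def pseudo_inverse_def Q_def B_def A_def ZT_def Z_def)
  have "beta_hat S m \<in> measurable N (borel_vec k)"
  proof (rule measurable_borel_vecI)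
    show "beta_hat S m d \<in> carrier_vec k" for d
      unfolding b by (rule mult_mat_vec_carrier[OF Qc]) (simp add: responses_def)
    fix i assume i: "i < k"
    have eq: "beta_hat S m d $ i = (\<Sum>l<m. Q d $$ (i, l) * snd (d l))" for d
      using i Qc[of d] by (auto simp: b responses_def scalar_prod_def atLeast0LessThan)
    have "snd \<in> borel_measurable (joint_space n)"
      unfolding joint_space_def by (rule measurable_snd)
    then have "(\<lambda>d. snd (d l)) \<in> borel_measurable N" if "l < m" for l
      by (rule measurable_compose[OF comp[OF that]])
    then show "(\<lambda>d. beta_hat S m d $ i) \<in> borel_measurable N"
      unfolding eq by (intro borel_measurable_sum borel_measurable_times) (auto intro: mQ[OF i])
  qed
  then show ?thesis unfolding N_def k_def .
qed

section \<open>Perturbation of the normal equations\<close>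

text \<open>The l1 norm, chosen because an entrywise bound on a matrix turns into an operator bound
  at the price of a factor \<open>k\<close>.\<close>

definition vec_l1 :: "real vec \<Rightarrow> real" where
  "vec_l1 v = (\<Sum>i<dim_vec v. \<bar>v $ i\<bar>)"

lemma vec_l1_nonneg [simp]: "0 \<le> vec_l1 v"
  by (simp add: vec_l1_def sum_nonneg)

lemma vec_l1_triangle:
  assumes "u \<in> carrier_vec k" and "v \<in> carrier_vec k"
  shows "vec_l1 (u + v) \<le> vec_l1 u + vec_l1 v"
proof -
  have "vec_l1 (u + v) = (\<Sum>i<k. \<bar>u $ i + v $ i\<bar>)" using assms by (simp add: vec_l1_def)
  also have "\<dots> \<le> (\<Sum>i<k. \<bar>u $ i\<bar> + \<bar>v $ i\<bar>)" by (intro sum_mono abs_triangle_ineq)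
  also have "\<dots> = vec_l1 u + vec_l1 v" using assms by (simp add: vec_l1_def sum.distrib)
  finally show ?thesis .
qed

lemma vec_l1_mult_mat_vec_le:
  assumes A: "A \<in> carrier_mat k k" and v: "v \<in> carrier_vec k"
    and a: "\<And>i j. i < k \<Longrightarrow> j < k \<Longrightarrow> \<bar>A $$ (i, j)\<bar> \<le> a"
  shows "vec_l1 (A *\<^sub>v v) \<le> real k * a * vec_l1 v"
proof -
  have "vec_l1 (A *\<^sub>v v) = (\<Sum>i<k. \<bar>\<Sum>j<k. A $$ (i, j) * v $ j\<bar>)"
    using A v by (auto simp: vec_l1_def scalar_prod_def atLeast0LessThan)
  also have "\<dots> \<le> (\<Sum>i<k. \<Sum>j<k. a * \<bar>v $ j\<bar>)"
    using a by (intro sum_mono order_trans[OF sum_abs]) (auto simp: abs_mult intro!: mult_right_mono)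
  also have "\<dots> = real k * a * vec_l1 v"
    using v by (simp add: vec_l1_def sum_distrib_left mult.assoc)
  finally show ?thesis .
qed

text \<open>
  Since \<open>c v = L (A v) + L ((c \<Lambda> - A) v)\<close>, the second term can be absorbed into the left-hand side.
\<close>

lemma vec_l1_le_perturbed:
  assumes L: "L \<in> carrier_mat k k" "\<And>i j. i < k \<Longrightarrow> j < k \<Longrightarrow> \<bar>L $$ (i, j)\<bar> \<le> r" "r \<ge> 0"
    and \<Lambda>: "\<Lambda> \<in> carrier_mat k k" "L * \<Lambda> = 1\<^sub>m k"
    and A: "A \<in> carrier_mat k k" "\<And>i j. i < k \<Longrightarrow> j < k \<Longrightarrow> \<bar>A $$ (i, j) - c * \<Lambda> $$ (i, j)\<bar> \<le> c * \<eta>"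
    and small: "real k * r * (real k * \<eta>) \<le> 1 / 2"
    and c: "c > 0" and v: "v \<in> carrier_vec k"
  shows "c * vec_l1 v \<le> 2 * real k * r * vec_l1 (A *\<^sub>v v)"
proof -
  \<comment> \<open>In the application \<open>c\<close> is the sample size and \<open>A\<close> the
    unnormalised Gram matrix, so that no division by m is needed.\<close>
  let ?E = "c \<cdot>\<^sub>m \<Lambda> - A"
  have E: "?E \<in> carrier_mat k k" using \<Lambda> A by auto
  have "v = L *\<^sub>v (\<Lambda> *\<^sub>v v)"
    using assoc_mult_mat_vec[OF L(1) \<Lambda>(1) v] \<Lambda>(2) v by simp
  then have "vec_l1 v \<le> real k * r * vec_l1 (\<Lambda> *\<^sub>v v)"
    using vec_l1_mult_mat_vec_le[OF L(1) mult_mat_vec_carrier[OF \<Lambda>(1) v] L(2)] by simp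
  then have 1: "c * vec_l1 v \<le> real k * r * (c * vec_l1 (\<Lambda> *\<^sub>v v))"
    using mult_left_mono[of _ _ c, OF _ less_imp_le[OF c]] by (simp add: mult.left_commute)
  have "c * vec_l1 (\<Lambda> *\<^sub>v v) = vec_l1 (c \<cdot>\<^sub>v (\<Lambda> *\<^sub>v v))"
    using c by (simp add: vec_l1_def sum_distrib_left abs_mult)
  also have "c \<cdot>\<^sub>v (\<Lambda> *\<^sub>v v) = A *\<^sub>v v + ?E *\<^sub>v v"
  proof (rule eq_vecI)
    fix i assume "i < dim_vec (A *\<^sub>v v + ?E *\<^sub>v v)"
    then have i: "i < k" using A(1) by simp
    have "(A *\<^sub>v v) $ i + (?E *\<^sub>v v) $ i = (\<Sum>j<k. A $$ (i, j) * v $ j + ?E $$ (i, j) * v $ j)"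
      using A(1) E v i by (simp only: sum.distrib) (simp add: scalar_prod_def atLeast0LessThan)
    also have "\<dots> = (\<Sum>j<k. c * (\<Lambda> $$ (i, j) * v $ j))"
      using A(1) \<Lambda>(1) i by (intro sum.cong) (auto simp: algebra_simps)
    also have "\<dots> = (c \<cdot>\<^sub>v (\<Lambda> *\<^sub>v v)) $ i"
      using \<Lambda>(1) v i by (simp add: scalar_prod_def atLeast0LessThan sum_distrib_left)
    finally show "(c \<cdot>\<^sub>v (\<Lambda> *\<^sub>v v)) $ i = (A *\<^sub>v v + ?E *\<^sub>v v) $ i"
      using A(1) \<Lambda>(1) i by simp
  qed (use \<Lambda>(1) A(1) in simp)
  also have "vec_l1 (A *\<^sub>v v + ?E *\<^sub>v v) \<le> vec_l1 (A *\<^sub>v v) + vec_l1 (?E *\<^sub>v v)"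
    by (rule vec_l1_triangle[OF mult_mat_vec_carrier[OF A(1) v] mult_mat_vec_carrier[OF E v]])
  also have "vec_l1 (?E *\<^sub>v v) \<le> real k * (c * \<eta>) * vec_l1 v"
    using A \<Lambda>(1) by (intro vec_l1_mult_mat_vec_le[OF E v]) (auto simp: abs_minus_commute)
  finally have "real k * r * (c * vec_l1 (\<Lambda> *\<^sub>v v)) \<le>
      real k * r * (vec_l1 (A *\<^sub>v v) + real k * (c * \<eta>) * vec_l1 v)"
    using L(3) by (intro mult_left_mono) auto
  also have "\<dots> = real k * r * vec_l1 (A *\<^sub>v v) + (real k * r * (real k * \<eta>)) * (c * vec_l1 v)"
    by (simp add: algebra_simps)
  also have "\<dots> \<le> real k * r * vec_l1 (A *\<^sub>v v) + 1 / 2 * (c * vec_l1 v)"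
    using small c by (intro add_left_mono mult_right_mono) auto
  finally show ?thesis using 1 by linarith
qed

text \<open>A purely deterministic statement about one data set. The lower bound \<open>low\<close>
  is used twice: on a kernel vector, which shows that the Gram matrix is nonsingular and that
  \<open>inv_mat\<close> returns a true inverse and not its default; and on the error of the
  coefficients, which the Gram matrix maps to the transposed design matrix applied to the
  residuals.\<close>

lemma vec_l1_beta_hat_error_le:
  fixes S m d \<beta>
  defines "k \<equiv> card S + 1" and "R \<equiv> \<lambda>l. regressor S (fst (d l))"
  assumes L: "L \<in> carrier_mat k k" "\<And>i j. i < k \<Longrightarrow> j < k \<Longrightarrow> \<bar>L $$ (i, j)\<bar> \<le> r" "r \<ge> 0"
    and \<Lambda>: "\<Lambda> \<in> carrier_mat k k" "L * \<Lambda> = 1\<^sub>m k"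
    and gram: "\<And>i j. i < k \<Longrightarrow> j < k \<Longrightarrow>
      \<bar>(\<Sum>l<m. R l $ i * R l $ j) - real m * \<Lambda> $$ (i, j)\<bar> \<le> real m * \<eta>"
    and small: "real k * r * (real k * \<eta>) \<le> 1 / 2"
    and m: "m > 0" and \<beta>: "\<beta> \<in> carrier_vec k"
  shows "real m * vec_l1 (beta_hat S m d - \<beta>) \<le>
      2 * real k * r * (\<Sum>j<k. \<bar>\<Sum>l<m. R l $ j * (snd (d l) - R l \<bullet> \<beta>)\<bar>)"
proof -
  define Z where "Z = design_mat S m d"
  define y where "y = responses m d"
  define A where "A = transpose_mat Z * Z"
  have Z: "Z \<in> carrier_mat m k" unfolding Z_def k_def by (rule design_mat_carrier)
  have ZT: "transpose_mat Z \<in> carrier_mat k m" using Z by simp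
  have y: "y \<in> carrier_vec m" by (simp add: y_def responses_def)
  have A: "A \<in> carrier_mat k k" using Z by (auto simp: A_def)
  have Zi: "Z $$ (l, j) = R l $ j" if "l < m" "j < k" for l j
    using that by (simp add: Z_def R_def k_def design_mat_index)
  have Ai: "A $$ (i, j) = (\<Sum>l<m. R l $ i * R l $ j)" if "i < k" "j < k" for i j
    using that Z Zi by (auto simp: A_def scalar_prod_def atLeast0LessThan)
  have low: "real m * vec_l1 v \<le> 2 * real k * r * vec_l1 (A *\<^sub>v v)" if "v \<in> carrier_vec k" for v
    by (rule vec_l1_le_perturbed[OF L \<Lambda> A _ small _ that]) (use gram m Ai in auto)
  have "det A \<noteq> 0"
  proof
    assume "det A = 0"
    then obtain v where v: "v \<in> carrier_vec k" "v \<noteq> 0\<^sub>v k" "A *\<^sub>v v = 0\<^sub>v k"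
      using det_0_iff_vec_prod_zero_field[OF A] by auto
    have "real m * vec_l1 v \<le> 0" using low[OF v(1)] v(3) by (simp add: vec_l1_def)
    then have "vec_l1 v = 0" using m vec_l1_nonneg[of v] by (simp add: mult_le_0_iff)
    then have "v = 0\<^sub>v k"
      using v(1) by (intro eq_vecI) (auto simp: vec_l1_def sum_nonneg_eq_0_iff)
    with v(2) show False ..
  qed
  then have inv: "A * inv_mat A = 1\<^sub>m k"
    using adj_mat(1,2)[OF A] A mult_smult_distrib[OF A adj_mat(1)[OF A], of "1 / det A"]
    by (simp add: inv_mat_eq_adj_mat[OF A]) (auto intro!: eq_matI)
  have I: "inv_mat A \<in> carrier_mat k k" by (rule inv_mat_carrier[OF A])
  have b: "beta_hat S m d = inv_mat A *\<^sub>v (transpose_mat Z *\<^sub>v y)"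
    using assoc_mult_mat_vec[OF I ZT y]
    by (simp add: beta_hat_def pseudo_inverse_def A_def Z_def y_def)
  then have bc: "beta_hat S m d \<in> carrier_vec k"
    using mult_mat_vec_carrier[OF I mult_mat_vec_carrier[OF ZT y]] by simp
  have "A *\<^sub>v (beta_hat S m d - \<beta>) = A *\<^sub>v beta_hat S m d - A *\<^sub>v \<beta>"
    by (rule mult_minus_distrib_mat_vec[OF A bc \<beta>])
  also have "A *\<^sub>v beta_hat S m d = transpose_mat Z *\<^sub>v y"
    unfolding b
    using assoc_mult_mat_vec[OF A I mult_mat_vec_carrier[OF ZT y]] inv mult_mat_vec_carrier[OF ZT y] by simp
  also have "A *\<^sub>v \<beta> = transpose_mat Z *\<^sub>v (Z *\<^sub>v \<beta>)"
    unfolding A_def by (rule assoc_mult_mat_vec[OF ZT Z \<beta>])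
  also have "transpose_mat Z *\<^sub>v y - transpose_mat Z *\<^sub>v (Z *\<^sub>v \<beta>) = transpose_mat Z *\<^sub>v (y - Z *\<^sub>v \<beta>)"
    by (rule mult_minus_distrib_mat_vec[OF ZT y mult_mat_vec_carrier[OF Z \<beta>], symmetric])
  finally have eq: "A *\<^sub>v (beta_hat S m d - \<beta>) = transpose_mat Z *\<^sub>v (y - Z *\<^sub>v \<beta>)" .
  have "row Z l = R l" if "l < m" for l
    using that Z Zi by (intro eq_vecI) (auto simp: R_def k_def regressor_def)
  then have "(transpose_mat Z *\<^sub>v (y - Z *\<^sub>v \<beta>)) $ j = (\<Sum>l<m. R l $ j * (snd (d l) - R l \<bullet> \<beta>))"
    if "j < k" for j
    using that Z Zi by (auto simp: scalar_prod_def[of "col Z j"] atLeast0LessThan y_def responses_def intro!: sum.cong)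
  then have "vec_l1 (A *\<^sub>v (beta_hat S m d - \<beta>)) = (\<Sum>j<k. \<bar>\<Sum>l<m. R l $ j * (snd (d l) - R l \<bullet> \<beta>)\<bar>)"
    unfolding eq using Z by (auto simp: vec_l1_def)
  then show ?thesis
    using low[of "beta_hat S m d - \<beta>"] bc \<beta> by simp
qed

section \<open>Conditioning on independent data\<close>

lemma borel_measurable_nn_integral_compose:
  assumes "prob_space M" and V: "V \<in> measurable M MV"
    and f: "f \<in> borel_measurable (MU \<Otimes>\<^sub>M MV)"
  shows "(\<lambda>u. \<integral>\<^sup>+\<omega>. f (u, V \<omega>) \<partial>M) \<in> borel_measurable MU"
proof -
  interpret prob_space M by fact
  have "(\<lambda>p. (fst p, V (snd p))) \<in> measurable (MU \<Otimes>\<^sub>M M) (MU \<Otimes>\<^sub>M MV)"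
    using V by measurable
  from measurable_compose[OF this f]
  have "(\<lambda>(u, \<omega>). f (u, V \<omega>)) \<in> borel_measurable (MU \<Otimes>\<^sub>M M)" by (simp add: case_prod_beta)
  then show ?thesis by (rule borel_measurable_nn_integral)
qed

text \<open>The freezing lemma. The defining property of the conditional expectation has to be
  checked on preimages of measurable sets under the conditioning variable only, and there it is an
  instance of Fubini.\<close>

lemma nn_cond_exp_indep_rv:
  assumes "prob_space P" and indep: "indep_rv P MU U MV V"
    and g: "g \<in> measurable MU MW" and f: "f \<in> borel_measurable (MW \<Otimes>\<^sub>M MV)"
  shows "AE \<omega> in P. nn_cond_exp P (vimage_algebra (space P) (\<lambda>\<omega>. g (U \<omega>)) MW)
      (\<lambda>\<omega>. f (g (U \<omega>), V \<omega>)) \<omega> = (\<integral>\<^sup>+\<omega>'. f (g (U \<omega>), V \<omega>') \<partial>P)"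
proof -
  interpret prob_space P by fact
  from indep have U: "U \<in> measurable P MU" and V: "V \<in> measurable P MV"
    by (auto simp: indep_rv_def)
  define b where "b \<omega> = g (U \<omega>)" for \<omega>
  have b: "b \<in> measurable P MW" unfolding b_def using U g by (rule measurable_compose)
  define F where "F = vimage_algebra (space P) b MW"
  have bF: "b \<in> measurable F MW"
    unfolding F_def using measurable_space[OF b] by (intro measurable_vimage_algebra1) auto
  have "subalgebra P F"
    unfolding subalgebra_def F_def using sets_image_in_sets[OF refl b] by simp
  then interpret finite_measure_subalgebra P F
    by (intro finite_measure_subalgebra.intro finite_measure_axioms) (simp add: finite_measure_subalgebra_axioms_def)
  define h where "h w = (\<integral>\<^sup>+\<omega>'. f (w, V \<omega>') \<partial>P)" for w
  have h: "h \<in> borel_measurable MW"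
    unfolding h_def by (rule borel_measurable_nn_integral_compose[OF assms(1) V f])
  have "AE \<omega> in P. h (b \<omega>) = nn_cond_exp P F (\<lambda>\<omega>. f (b \<omega>, V \<omega>)) \<omega>"
  proof (rule nn_cond_exp_charact)
    fix A assume "A \<in> sets F"
    then obtain B where B: "B \<in> sets MW" "A = b -` B \<inter> space P"
      unfolding F_def using measurable_space[OF b] by (subst (asm) sets_vimage_algebra2) auto
    \<comment> \<open>The indicator of the preimage is absorbed into the integrand as a function of
      the first variable, so that \<open>nn_integral_indep_rv\<close> applies to the restricted
      integral.\<close>
    define f' where "f' p = f (g (fst p), snd p) * indicator B (g (fst p))" for p
    have "(\<lambda>p. (g (fst p), snd p)) \<in> measurable (MU \<Otimes>\<^sub>M MV) (MW \<Otimes>\<^sub>M MV)"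
      using g by measurable
    note fm = measurable_compose[OF this f]
    have "(\<lambda>p. g (fst p)) \<in> measurable (MU \<Otimes>\<^sub>M MV) MW" using g by measurable
    note im = measurable_compose[OF this borel_measurable_indicator[OF B(1)]]
    have f': "f' \<in> borel_measurable (MU \<Otimes>\<^sub>M MV)"
      unfolding f'_def using fm im by (rule borel_measurable_times_ennreal)
    have "(\<integral>\<^sup>+\<omega>\<in>A. f (b \<omega>, V \<omega>) \<partial>P) = (\<integral>\<^sup>+\<omega>. f' (U \<omega>, V \<omega>) \<partial>P)"
      by (intro nn_integral_cong) (auto simp: f'_def b_def B indicator_def)
    also have "\<dots> = (\<integral>\<^sup>+\<omega>. (\<integral>\<^sup>+\<omega>'. f' (U \<omega>, V \<omega>') \<partial>P) \<partial>P)"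
      by (rule nn_integral_indep_rv[OF assms(1) indep f'])
    also have "\<dots> = (\<integral>\<^sup>+\<omega>\<in>A. h (b \<omega>) \<partial>P)"
      by (intro nn_integral_cong) (auto simp: f'_def b_def B h_def indicator_def)
    finally show "(\<integral>\<^sup>+\<omega>\<in>A. f (b \<omega>, V \<omega>) \<partial>P) = (\<integral>\<^sup>+\<omega>\<in>A. h (b \<omega>) \<partial>P)" .
  next
    show "(\<lambda>\<omega>. f (b \<omega>, V \<omega>)) \<in> borel_measurable P"
      by (rule measurable_compose[OF measurable_Pair[OF b V] f])
    show "(\<lambda>\<omega>. h (b \<omega>)) \<in> borel_measurable F"
      by (rule measurable_compose[OF bF h])
  qed
  then show ?thesis
    unfolding F_def b_def h_def by (auto elim!: eventually_mono)
qed

section \<open>Transfer from the model to its samples, and moment facts\<close>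

lemma
  assumes "iid_samples P N (distr M N Z) m D" and "l < m" and "prob_space P"
    and Z: "Z \<in> measurable M N"
  shows iid_samples_measurable: "D l \<in> measurable P N"
    and iid_samples_integrable:
      "f \<in> borel_measurable N \<Longrightarrow> integrable P (\<lambda>\<omega>. f (D l \<omega>) :: real) \<longleftrightarrow> integrable M (\<lambda>\<omega>. f (Z \<omega>))"
    and iid_samples_integral:
      "f \<in> borel_measurable N \<Longrightarrow> (\<integral>\<omega>. f (D l \<omega>) \<partial>P) = (\<integral>\<omega>. f (Z \<omega>) \<partial>M)"
    and iid_samples_nn_integral:
      "g \<in> borel_measurable N \<Longrightarrow> (\<integral>\<^sup>+\<omega>. g (D l \<omega>) \<partial>P) = (\<integral>\<^sup>+\<omega>. g (Z \<omega>) \<partial>M)"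
    and iid_samples_AE:
      "{x \<in> space N. Q x} \<in> sets N \<Longrightarrow> (AE \<omega> in P. Q (D l \<omega>)) \<longleftrightarrow> (AE \<omega> in M. Q (Z \<omega>))"
proof -
  interpret prob_space P by fact
  from assms(1,2) show D: "D l \<in> measurable P N"
    by (auto simp: iid_samples_def indep_vars_def)
  have eq: "distr P N (D l) = distr M N Z" using assms(1,2) by (auto simp: iid_samples_def)
  show "integrable P (\<lambda>\<omega>. f (D l \<omega>) :: real) \<longleftrightarrow> integrable M (\<lambda>\<omega>. f (Z \<omega>))"
    if "f \<in> borel_measurable N"
    using integrable_distr_eq[OF D that] integrable_distr_eq[OF Z that] eq by simp
  show "(\<integral>\<omega>. f (D l \<omega>) \<partial>P) = (\<integral>\<omega>. f (Z \<omega>) \<partial>M)" if "f \<in> borel_measurable N"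
    using integral_distr[OF D that] integral_distr[OF Z that] eq by simp
  show "(\<integral>\<^sup>+\<omega>. g (D l \<omega>) \<partial>P) = (\<integral>\<^sup>+\<omega>. g (Z \<omega>) \<partial>M)" if "g \<in> borel_measurable N"
    using nn_integral_distr[OF D, of g] nn_integral_distr[OF Z, of g] that eq by simp
  show "(AE \<omega> in P. Q (D l \<omega>)) \<longleftrightarrow> (AE \<omega> in M. Q (Z \<omega>))" if "{x \<in> space N. Q x} \<in> sets N"
    using AE_distr_iff[OF D that] AE_distr_iff[OF Z that] unfolding eq by metis
qed

lemma (in prob_space)
  fixes W :: "nat \<Rightarrow> 'a \<Rightarrow> real"
  assumes indep: "indep_vars (\<lambda>_. borel) W {..<m}"
    and int: "\<And>l. l < m \<Longrightarrow> integrable M (W l)" and int2: "\<And>l. l < m \<Longrightarrow> integrable M (\<lambda>\<omega>. (W l \<omega>)\<^sup>2)"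
    and centered: "\<And>l. l < m \<Longrightarrow> expectation (W l) = 0"
  shows integrable_square_sum_indep: "integrable M (\<lambda>\<omega>. (\<Sum>l<m. W l \<omega>)\<^sup>2)"
    and expectation_square_sum_indep:
      "expectation (\<lambda>\<omega>. (\<Sum>l<m. W l \<omega>)\<^sup>2) = (\<Sum>l<m. expectation (\<lambda>\<omega>. (W l \<omega>)\<^sup>2))"
proof -
  have "integrable M (\<lambda>\<omega>. (\<Sum>l<j. W l \<omega>)\<^sup>2) \<and>
      expectation (\<lambda>\<omega>. (\<Sum>l<j. W l \<omega>)\<^sup>2) = (\<Sum>l<j. expectation (\<lambda>\<omega>. (W l \<omega>)\<^sup>2))" if "j \<le> m" for j
    using that
  proof (induction j)
    case (Suc j)
    define S where "S \<omega> = (\<Sum>l<j. W l \<omega>)" for \<omega>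
    from Suc have j: "j < m" by simp
    have "indep_vars (\<lambda>_. borel) W (insert j {..<j})"
      using j by (intro indep_vars_subset[OF indep]) auto
    then have ind: "indep_var borel (W j) borel S"
      unfolding S_def by (intro indep_vars_sum) auto
    have S1: "integrable M S"
      unfolding S_def using j int by (intro Bochner_Integration.integrable_sum) auto
    have ES: "expectation S = 0"
      unfolding S_def using j int centered by (subst Bochner_Integration.integral_sum) auto
    have S2: "integrable M (\<lambda>\<omega>. (S \<omega>)\<^sup>2)" using Suc by (simp add: S_def)
    have q: "q = 0 \<or> q = 1 \<or> q = 2" if "q \<le> 2" for q :: nat using that by auto
    have iW: "integrable M (\<lambda>\<omega>. W j \<omega> ^ q)" and iS: "integrable M (\<lambda>\<omega>. S \<omega> ^ q)" if "q \<le> 2" for q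
      using q[OF that] int[OF j] int2[OF j] S1 S2 by auto
    have "expectation (\<lambda>\<omega>. (W j \<omega> + S \<omega>)\<^sup>2) =
        expectation (\<lambda>\<omega>. (S \<omega>)\<^sup>2) + expectation (\<lambda>\<omega>. (W j \<omega>)\<^sup>2)"
      using expectation_power_add_indep[where p = 2, OF ind iW iS] centered[OF j] ES
      by (simp add: eval_nat_numeral prob_space)
    moreover have "integrable M (\<lambda>\<omega>. (W j \<omega> + S \<omega>)\<^sup>2)"
      by (rule integrable_power_add_indep[OF ind iW iS])
    moreover have "(\<Sum>l<Suc j. W l \<omega>) = W j \<omega> + S \<omega>" for \<omega> by (simp add: S_def)
    moreover have "expectation (\<lambda>\<omega>. (S \<omega>)\<^sup>2) = (\<Sum>l<j. expectation (\<lambda>\<omega>. (W l \<omega>)\<^sup>2))"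
      using Suc by (simp add: S_def)
    ultimately show ?case by (simp only:) simp
  qed simp
  from this[of m] show "integrable M (\<lambda>\<omega>. (\<Sum>l<m. W l \<omega>)\<^sup>2)"
    and "expectation (\<lambda>\<omega>. (\<Sum>l<m. W l \<omega>)\<^sup>2) = (\<Sum>l<m. expectation (\<lambda>\<omega>. (W l \<omega>)\<^sup>2))"
    by auto
qed

text \<open>No attainment of the infimum is claimed: the infimum of the empty set is infinite, so a
  finite norm yields some admissible constant.\<close>

lemma psi_norm_finiteE:
  assumes "psi_norm M \<alpha> W < \<infinity>"
  obtains C where "C > 0" "(\<integral>\<^sup>+\<omega>. ennreal (exp (\<bar>W \<omega>\<bar> powr \<alpha> / C powr \<alpha>)) \<partial>M) \<le> 2"
proof -
  have "{ennreal C | C. C > 0 \<and> (\<integral>\<^sup>+\<omega>. ennreal (exp (\<bar>W \<omega>\<bar> powr \<alpha> / C powr \<alpha>)) \<partial>M) \<le> 2} \<noteq> {}"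
  proof
    assume "{ennreal C | C. C > 0 \<and> (\<integral>\<^sup>+\<omega>. ennreal (exp (\<bar>W \<omega>\<bar> powr \<alpha> / C powr \<alpha>)) \<partial>M) \<le> 2} = {}"
    with assms show False unfolding psi_norm_def by (simp only: Inf_empty) simp
  qed
  then show ?thesis using that by auto
qed

lemma (in prob_space) integrable_power_of_psi_norm:
  fixes W :: "'a \<Rightarrow> real"
  assumes [measurable]: "W \<in> borel_measurable M" and psi: "psi_norm M 1 W < \<infinity>"
  shows "integrable M (\<lambda>\<omega>. \<bar>W \<omega>\<bar> ^ q)"
proof (cases "q = 0")
  case False
  from psi obtain C where C: "C > 0" and e: "(\<integral>\<^sup>+\<omega>. ennreal (exp (\<bar>W \<omega>\<bar> powr 1 / C powr 1)) \<partial>M) \<le> 2"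
    by (rule psi_norm_finiteE)
  have "(\<integral>\<^sup>+\<omega>. ennreal (exp (\<bar>W \<omega>\<bar> / C)) \<partial>M) \<le> 2" using e C by simp
  then have int: "integrable M (\<lambda>\<omega>. exp (\<bar>W \<omega>\<bar> / C))"
    by (intro integrableI_nonneg) (auto intro: le_less_trans)
  have le: "\<bar>W \<omega>\<bar> ^ q \<le> (C * real q) ^ q * exp (\<bar>W \<omega>\<bar> / C)" for \<omega>
  proof -
    \<comment> \<open>Dividing by \<open>q\<close> as well as by \<open>C\<close> makes the q-th
      power of exp x equal to exp (|W| / C), whose integral is finite.\<close>
    define x where "x = \<bar>W \<omega>\<bar> / C / real q"
    have x: "0 \<le> x" using C by (simp add: x_def)
    have "x \<le> exp x" using exp_ge_add_one_self[of x] by linarith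
    then have "x ^ q \<le> exp x ^ q" using x by (intro power_mono) auto
    also have "exp x ^ q = exp (\<bar>W \<omega>\<bar> / C)"
      using False by (simp add: x_def flip: exp_of_nat_mult)
    finally have "(C * real q) ^ q * x ^ q \<le> (C * real q) ^ q * exp (\<bar>W \<omega>\<bar> / C)"
      using C by (intro mult_left_mono) auto
    moreover have "(C * real q) * x = \<bar>W \<omega>\<bar>" using C False by (simp add: x_def)
    ultimately show ?thesis by (simp flip: power_mult_distrib)
  qed
  show ?thesis
    by (rule Bochner_Integration.integrable_bound[OF integrable_mult_right[OF int, of "(C * real q) ^ q"]])
       (use le C in \<open>auto simp: abs_mult\<close>)
qed simp

text \<open>The sampling scheme states independence for the exploration data restricted to the
  indices below \<open>m\<close>, while the error is conditioned on the estimator of the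
  unrestricted family; this identifies the two estimators.\<close>

lemma beta_hat_cong:
  assumes "\<And>l. l < m \<Longrightarrow> d l = d' l"
  shows "beta_hat S m d = beta_hat S m d'"
proof -
  have "design_mat S m d = design_mat S m d'"
    unfolding design_mat_def using assms by (intro arg_cong2[where f = mat_of_rows] map_cong) auto
  moreover have "responses m d = responses m d'"
    unfolding responses_def using assms by (intro eq_vecI) auto
  ultimately show ?thesis by (simp add: beta_hat_def)
qed

lemma borel_measurable_LRMC:
  "(\<lambda>p. LRMC N (snd p) (fst p)) \<in> borel_measurable (borel_vec k \<Otimes>\<^sub>M (\<Pi>\<^sub>M l\<in>{..<N}. borel_vec k))"
proof -
  let ?N = "borel_vec k \<Otimes>\<^sub>M (\<Pi>\<^sub>M l\<in>{..<N}. borel_vec k)"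
  have fst: "fst \<in> measurable ?N (borel_vec k)" by (rule measurable_fst)
  have snd: "(\<lambda>p. snd p l) \<in> measurable ?N (borel_vec k)" if "l < N" for l
    using that by (intro measurable_compose[OF measurable_snd measurable_component_singleton]) auto
  have "(\<lambda>p. snd p l \<bullet> fst p) \<in> borel_measurable ?N" if "l < N" for l
    using measurable_space[OF fst]
    by (intro borel_measurable_scalar_prod[of _ _ k] borel_measurable_vec_index[OF snd[OF that]]
        borel_measurable_vec_index[OF fst]) auto
  then show ?thesis
    unfolding LRMC_def by (intro borel_measurable_times borel_measurable_sum borel_measurable_const) auto
qed

section \<open>The regression model\<close>

locale regression_model = prob_space M for M :: "'a measure" +
  fixes n :: nat and X :: "nat \<Rightarrow> 'a \<Rightarrow> real" and fY :: "'a \<Rightarrow> real" and S :: "nat set"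
    and \<beta> :: "real vec" and \<epsilon> :: "'a \<Rightarrow> real" and \<sigma> :: real
  assumes X: "\<And>i. i \<in> {1..n} \<Longrightarrow> X i \<in> borel_measurable M"
    and fY: "fY \<in> borel_measurable M"
    and S: "S \<subseteq> {1..n}"
    and model: "linear_model M X fY S \<beta> \<epsilon> \<sigma>"
    and psi: "psi_norm M 1 (\<lambda>\<omega>. vec_norm2 (XS X S \<omega>)) < \<infinity>"
begin

definition k :: nat where "k = card S + 1"

definition Xv :: "'a \<Rightarrow> real vec" where "Xv = XS X S"

definition nrm :: "'a \<Rightarrow> real" where "nrm \<omega> = vec_norm2 (Xv \<omega>)"

definition variance_along :: "real vec \<Rightarrow> real" where
  "variance_along b = (\<integral>\<omega>. (Xv \<omega> \<bullet> b - (\<integral>\<omega>'. Xv \<omega>' \<bullet> b \<partial>M))\<^sup>2 \<partial>M)"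

lemma Xv_carrier: "Xv \<omega> \<in> carrier_vec k"
  unfolding Xv_def XS_def k_def by (rule regressor_carrier)

lemma Xv_measurable: "Xv \<in> measurable M (borel_vec k)"
proof (rule measurable_borel_vecI)
  show "(\<lambda>\<omega>. Xv \<omega> $ i) \<in> borel_measurable M" if "i < k" for i
    unfolding Xv_def XS_def using that X unfolding k_def
    by (intro borel_measurable_regressor_index[OF S])
qed (rule Xv_carrier)

lemma Xv_index_measurable [measurable]: "i < k \<Longrightarrow> (\<lambda>\<omega>. Xv \<omega> $ i) \<in> borel_measurable M"
  by (rule borel_measurable_vec_index[OF Xv_measurable])

lemma Xv_scalar_prod: "b \<in> carrier_vec k \<Longrightarrow> Xv \<omega> \<bullet> b = (\<Sum>i<k. Xv \<omega> $ i * b $ i)"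
  by (simp add: scalar_prod_def atLeast0LessThan)

lemma Xv_scalar_prod_measurable: "b \<in> carrier_vec k \<Longrightarrow> (\<lambda>\<omega>. Xv \<omega> \<bullet> b) \<in> borel_measurable M"
  by (rule borel_measurable_scalar_prod[of _ _ k]) auto

lemma nrm_eq: "nrm \<omega> = sqrt (\<Sum>i<k. (Xv \<omega> $ i)\<^sup>2)"
  using Xv_carrier[of \<omega>] by (simp add: nrm_def vec_norm2_def scalar_prod_def atLeast0LessThan power2_eq_square)

lemma nrm_measurable [measurable]: "nrm \<in> borel_measurable M"
proof -
  have "(\<lambda>\<omega>. \<Sum>i<k. (Xv \<omega> $ i)\<^sup>2) \<in> borel_measurable M"
    by (intro borel_measurable_sum borel_measurable_power) auto
  then show ?thesis unfolding nrm_eq[abs_def] by measurable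
qed

lemma nrm_nonneg: "0 \<le> nrm \<omega>"
  by (simp add: nrm_eq sum_nonneg)

lemma abs_Xv_index_le: "i < k \<Longrightarrow> \<bar>Xv \<omega> $ i\<bar> \<le> nrm \<omega>"
  unfolding nrm_eq by (intro real_le_rsqrt) (auto intro: member_le_sum[of i "{..<k}" "\<lambda>i. (Xv \<omega> $ i)\<^sup>2"])

lemma integrable_nrm_power: "integrable M (\<lambda>\<omega>. nrm \<omega> ^ q)"
  using integrable_power_of_psi_norm[OF nrm_measurable, of q] psi
  by (simp add: nrm_def[abs_def] Xv_def abs_of_nonneg[OF nrm_nonneg[unfolded nrm_def Xv_def]])

text \<open>The common source of the integrability facts about the regressor: the finite psi norm
  makes every power of \<open>nrm\<close> integrable.\<close>

lemma integrable_dominated_nrm_power: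
  assumes "f \<in> borel_measurable M" and "\<And>\<omega>. \<bar>f \<omega>\<bar> \<le> a * nrm \<omega> ^ q"
  shows "integrable M (f :: 'a \<Rightarrow> real)"
  by (rule Bochner_Integration.integrable_bound[OF integrable_mult_right[OF integrable_nrm_power]])
     (use assms order_trans[OF _ abs_ge_self] in \<open>auto\<close>)

lemma integrable_Xv_index: "i < k \<Longrightarrow> integrable M (\<lambda>\<omega>. Xv \<omega> $ i)"
  by (rule integrable_dominated_nrm_power[of _ 1 1]) (auto intro: abs_Xv_index_le)

lemma integrable_Xv_prod_power:
  assumes "i < k" "j < k"
  shows "integrable M (\<lambda>\<omega>. (Xv \<omega> $ i * Xv \<omega> $ j) ^ q)"
proof (rule integrable_dominated_nrm_power[of _ 1 "2 * q"])
  show "\<bar>(Xv \<omega> $ i * Xv \<omega> $ j) ^ q\<bar> \<le> 1 * nrm \<omega> ^ (2 * q)" for \<omega>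
    unfolding power_abs abs_mult power_mult mult_1 power2_eq_square
    using assms by (intro power_mono mult_mono abs_Xv_index_le nrm_nonneg) auto
qed (use assms in measurable)

lemma integrable_Xv_prod: "i < k \<Longrightarrow> j < k \<Longrightarrow> integrable M (\<lambda>\<omega>. Xv \<omega> $ i * Xv \<omega> $ j)"
  using integrable_Xv_prod_power[of i j 1] by simp

lemma abs_Xv_scalar_prod_le:
  assumes "b \<in> carrier_vec k"
  shows "\<bar>Xv \<omega> \<bullet> b\<bar> \<le> nrm \<omega> * vec_l1 b"
proof -
  have "\<bar>Xv \<omega> \<bullet> b\<bar> \<le> (\<Sum>i<k. \<bar>Xv \<omega> $ i * b $ i\<bar>)" unfolding Xv_scalar_prod[OF assms] by (rule sum_abs)
  also have "\<dots> \<le> (\<Sum>i<k. nrm \<omega> * \<bar>b $ i\<bar>)"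
    unfolding abs_mult by (intro sum_mono mult_right_mono abs_Xv_index_le) auto
  also have "\<dots> = nrm \<omega> * vec_l1 b" using assms by (simp add: vec_l1_def sum_distrib_left)
  finally show ?thesis .
qed

lemma integrable_Xv_scalar_prod:
  assumes "b \<in> carrier_vec k"
  shows "integrable M (\<lambda>\<omega>. Xv \<omega> \<bullet> b)"
  using abs_Xv_scalar_prod_le[OF assms] Xv_scalar_prod_measurable[OF assms]
  by (intro integrable_dominated_nrm_power[of _ "vec_l1 b" 1]) (auto simp: mult.commute)

lemma square_Xv_scalar_prod_le:
  assumes "b \<in> carrier_vec k"
  shows "(Xv \<omega> \<bullet> b)\<^sup>2 \<le> (vec_l1 b)\<^sup>2 * (nrm \<omega>)\<^sup>2"
proof -
  have "\<bar>Xv \<omega> \<bullet> b\<bar>\<^sup>2 \<le> (nrm \<omega> * vec_l1 b)\<^sup>2"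
    by (rule power_mono[OF abs_Xv_scalar_prod_le[OF assms]]) auto
  then show ?thesis by (simp add: power_mult_distrib mult.commute)
qed

lemma integrable_square_Xv_scalar_prod:
  assumes "b \<in> carrier_vec k"
  shows "integrable M (\<lambda>\<omega>. (Xv \<omega> \<bullet> b)\<^sup>2)"
  using square_Xv_scalar_prod_le[OF assms] Xv_scalar_prod_measurable[OF assms]
  by (intro integrable_dominated_nrm_power[of _ "(vec_l1 b)\<^sup>2" 2]) auto

lemma integrable_square_centered:
  assumes "b \<in> carrier_vec k"
  shows "integrable M (\<lambda>\<omega>. (Xv \<omega> \<bullet> b - c)\<^sup>2)"
proof -
  have "(\<lambda>\<omega>. (Xv \<omega> \<bullet> b - c)\<^sup>2) = (\<lambda>\<omega>. (Xv \<omega> \<bullet> b)\<^sup>2 - 2 * c * (Xv \<omega> \<bullet> b) + c\<^sup>2)"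
    by (auto simp: power2_eq_square algebra_simps)
  then show ?thesis
    using integrable_Xv_scalar_prod[OF assms] integrable_square_Xv_scalar_prod[OF assms] by simp
qed

text \<open>Allows the whole argument to run on variances of scalar variables; the covariance matrix
  returns only when the final bound is rewritten.\<close>

lemma cov_mat_quadratic_form:
  assumes b: "b \<in> carrier_vec k"
  shows "b \<bullet> (cov_mat M k Xv *\<^sub>v b) = variance_along b"
proof -
  define x where "x i = (\<integral>\<omega>. Xv \<omega> $ i \<partial>M)" for i
  have int: "integrable M (\<lambda>\<omega>. (Xv \<omega> $ i - x i) * (Xv \<omega> $ j - x j))" if "i < k" "j < k" for i j
    using integrable_Xv_prod[OF that] integrable_Xv_index[OF that(1)] integrable_Xv_index[OF that(2)]
    by (simp add: left_diff_distrib right_diff_distrib)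
  have mean: "(\<integral>\<omega>. Xv \<omega> \<bullet> b \<partial>M) = (\<Sum>i<k. x i * b $ i)"
    unfolding Xv_scalar_prod[OF b] x_def using integrable_Xv_index
    by (subst Bochner_Integration.integral_sum) auto
  have "(Xv \<omega> \<bullet> b - (\<Sum>i<k. x i * b $ i))\<^sup>2 =
      (\<Sum>i<k. \<Sum>j<k. (b $ i * b $ j) * ((Xv \<omega> $ i - x i) * (Xv \<omega> $ j - x j)))" for \<omega>
    unfolding Xv_scalar_prod[OF b] power2_eq_square sum_subtractf[symmetric] left_diff_distrib[symmetric] sum_product
    by (intro sum.cong) (auto simp: ac_simps)
  then have "variance_along b =
      (\<integral>\<omega>. (\<Sum>i<k. \<Sum>j<k. (b $ i * b $ j) * ((Xv \<omega> $ i - x i) * (Xv \<omega> $ j - x j))) \<partial>M)"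
    unfolding variance_along_def mean by simp
  also have "\<dots> = (\<Sum>i<k. \<integral>\<omega>. (\<Sum>j<k. (b $ i * b $ j) * ((Xv \<omega> $ i - x i) * (Xv \<omega> $ j - x j))) \<partial>M)"
    by (intro Bochner_Integration.integral_sum Bochner_Integration.integrable_sum integrable_mult_right int) auto
  also have "\<dots> = (\<Sum>i<k. \<Sum>j<k. \<integral>\<omega>. (b $ i * b $ j) * ((Xv \<omega> $ i - x i) * (Xv \<omega> $ j - x j)) \<partial>M)"
    by (intro sum.cong refl Bochner_Integration.integral_sum integrable_mult_right int) auto
  also have "\<dots> = (\<Sum>i<k. \<Sum>j<k. (b $ i * b $ j) * (\<integral>\<omega>. (Xv \<omega> $ i - x i) * (Xv \<omega> $ j - x j) \<partial>M))"
    by simp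
  also have "\<dots> = (\<Sum>i<k. \<Sum>j<k. (b $ i * b $ j) * cov_mat M k Xv $$ (i, j))"
    by (intro sum.cong) (auto simp: cov_mat_def x_def)
  also have "\<dots> = b \<bullet> (cov_mat M k Xv *\<^sub>v b)"
    using b by (simp add: scalar_prod_def atLeast0LessThan sum_distrib_left cov_mat_def ac_simps)
  finally show ?thesis ..
qed

lemma variance_along_nonneg: "0 \<le> variance_along b"
  unfolding variance_along_def by (intro Bochner_Integration.integral_nonneg) simp

lemma second_moment_along:
  assumes b: "b \<in> carrier_vec k"
  shows "(\<integral>\<omega>. (Xv \<omega> \<bullet> b)\<^sup>2 \<partial>M) = variance_along b + (\<integral>\<omega>. Xv \<omega> \<bullet> b \<partial>M)\<^sup>2"
  unfolding variance_along_def
  using variance_eq[OF integrable_Xv_scalar_prod[OF b] integrable_square_Xv_scalar_prod[OF b]] by simp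

lemma second_moment_along_le:
  assumes b: "b \<in> carrier_vec k"
  shows "(\<integral>\<omega>. (Xv \<omega> \<bullet> b)\<^sup>2 \<partial>M) \<le> (vec_l1 b)\<^sup>2 * (\<integral>\<omega>. (nrm \<omega>)\<^sup>2 \<partial>M)"
proof -
  have "(\<integral>\<omega>. (Xv \<omega> \<bullet> b)\<^sup>2 \<partial>M) \<le> (\<integral>\<omega>. (vec_l1 b)\<^sup>2 * (nrm \<omega>)\<^sup>2 \<partial>M)"
    by (intro integral_mono integrable_square_Xv_scalar_prod[OF b] integrable_mult_right
        integrable_nrm_power square_Xv_scalar_prod_le[OF b])
  then show ?thesis by simp
qed

text \<open>Integrates (p + q)^2 <= 2 p^2 + 2 q^2 for the centred parts along \<open>c\<close> and
  along \<open>b - c\<close>. With \<open>c\<close> the true coefficients, this separates the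
  variance that the claim tolerates from one that is small because the estimation error is.\<close>

lemma variance_along_le:
  assumes b: "b \<in> carrier_vec k" and c: "c \<in> carrier_vec k"
  shows "variance_along b \<le> 2 * variance_along c + 2 * variance_along (b - c)"
proof -
  define p q where "p \<omega> = Xv \<omega> \<bullet> c - (\<integral>\<omega>'. Xv \<omega>' \<bullet> c \<partial>M)"
    and "q \<omega> = Xv \<omega> \<bullet> (b - c) - (\<integral>\<omega>'. Xv \<omega>' \<bullet> (b - c) \<partial>M)" for \<omega>
  have d: "b - c \<in> carrier_vec k" using b c by simp
  have "Xv \<omega> \<bullet> b = Xv \<omega> \<bullet> c + Xv \<omega> \<bullet> (b - c)" for \<omega>
    using scalar_prod_minus_distrib[OF Xv_carrier b c] by simp
  then have "variance_along b = (\<integral>\<omega>. (p \<omega> + q \<omega>)\<^sup>2 \<partial>M)"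
    unfolding variance_along_def p_def q_def
    using integrable_Xv_scalar_prod[OF c] integrable_Xv_scalar_prod[OF d]
    by (simp add: algebra_simps)
  also have "\<dots> \<le> (\<integral>\<omega>. 2 * (p \<omega>)\<^sup>2 + 2 * (q \<omega>)\<^sup>2 \<partial>M)"
  proof (rule integral_mono_AE')
    show "integrable M (\<lambda>\<omega>. 2 * (p \<omega>)\<^sup>2 + 2 * (q \<omega>)\<^sup>2)"
      unfolding p_def q_def using integrable_square_centered[OF c] integrable_square_centered[OF d] by simp
    have "(p \<omega> + q \<omega>)\<^sup>2 \<le> 2 * (p \<omega>)\<^sup>2 + 2 * (q \<omega>)\<^sup>2" for \<omega>
      using zero_le_power2[of "p \<omega> - q \<omega>"] by (simp add: power2_eq_square algebra_simps)
    then show "AE \<omega> in M. (p \<omega> + q \<omega>)\<^sup>2 \<le> 2 * (p \<omega>)\<^sup>2 + 2 * (q \<omega>)\<^sup>2" by simp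
  qed auto
  also have "\<dots> = 2 * variance_along c + 2 * variance_along (b - c)"
    unfolding variance_along_def p_def q_def
    using integrable_square_centered[OF c] integrable_square_centered[OF d] by simp
  finally show ?thesis .
qed

section \<open>Consequences of the linear model\<close>

lemma \<beta>_carrier: "\<beta> \<in> carrier_vec k"
  using model by (simp add: linear_model_def k_def)

lemma AE_fY: "AE \<omega> in M. fY \<omega> = Xv \<omega> \<bullet> \<beta> + \<epsilon> \<omega>"
  using model by (simp add: linear_model_def Xv_def)

lemma \<epsilon>_measurable [measurable]: "\<epsilon> \<in> borel_measurable M"
  using model by (simp add: linear_model_def sub_gaussian_def)

lemma \<epsilon>_centered: "(\<integral>\<omega>. \<epsilon> \<omega> \<partial>M) = 0"
  using model by (simp add: linear_model_def)

lemma \<epsilon>_variance: "(\<integral>\<omega>. (\<epsilon> \<omega>)\<^sup>2 \<partial>M) = \<sigma>\<^sup>2"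
  using model by (auto simp: linear_model_def)

lemma \<epsilon>_indep: "indep_rv M borel \<epsilon> (borel_vec k) Xv"
  using model by (simp add: linear_model_def k_def Xv_def)

lemma \<epsilon>_exp_squareE:
  obtains C where "C > 0" "(\<integral>\<^sup>+\<omega>. ennreal (exp ((\<epsilon> \<omega>)\<^sup>2 / C\<^sup>2)) \<partial>M) \<le> 2"
proof -
  have "psi_norm M 2 \<epsilon> < \<infinity>" using model by (simp add: linear_model_def sub_gaussian_def)
  then obtain C where C: "C > 0" "(\<integral>\<^sup>+\<omega>. ennreal (exp (\<bar>\<epsilon> \<omega>\<bar> powr 2 / C powr 2)) \<partial>M) \<le> 2"
    by (rule psi_norm_finiteE)
  moreover have "\<bar>\<epsilon> \<omega>\<bar> powr 2 / C powr 2 = (\<epsilon> \<omega>)\<^sup>2 / C\<^sup>2" for \<omega>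
    using C(1) by (simp add: powr_realpow'[of _ 2, simplified])
  ultimately show ?thesis using that by simp
qed

lemma \<epsilon>_integrable: "integrable M \<epsilon>" and \<epsilon>_square_integrable: "integrable M (\<lambda>\<omega>. (\<epsilon> \<omega>)\<^sup>2)"
proof -
  obtain C where "C > 0" "(\<integral>\<^sup>+\<omega>. ennreal (exp ((\<epsilon> \<omega>)\<^sup>2 / C\<^sup>2)) \<partial>M) \<le> 2" by (rule \<epsilon>_exp_squareE)
  from nn_integral_exp_le_of_exp_square(1,2)[OF \<epsilon>_measurable this \<epsilon>_centered]
  show "integrable M \<epsilon>" "integrable M (\<lambda>\<omega>. (\<epsilon> \<omega>)\<^sup>2)" by auto
qed

lemma \<epsilon>_mgf: obtains v where "v > 0" "\<And>s. (\<integral>\<^sup>+\<omega>. ennreal (exp (s * \<epsilon> \<omega>)) \<partial>M) \<le> ennreal (exp (v * s\<^sup>2))"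
proof -
  obtain C where C: "C > 0" "(\<integral>\<^sup>+\<omega>. ennreal (exp ((\<epsilon> \<omega>)\<^sup>2 / C\<^sup>2)) \<partial>M) \<le> 2" by (rule \<epsilon>_exp_squareE)
  from nn_integral_exp_le_of_exp_square(3)[OF \<epsilon>_measurable C \<epsilon>_centered] C(1) show ?thesis
    by (intro that[of "2 * C\<^sup>2"]) auto
qed

lemma \<epsilon>_eq_0: "\<sigma> = 0 \<Longrightarrow> AE \<omega> in M. \<epsilon> \<omega> = 0"
  using integral_nonneg_eq_0_iff_AE[OF \<epsilon>_square_integrable] \<epsilon>_variance by simp

lemma expectation_fY: "(\<integral>\<omega>. fY \<omega> \<partial>M) = (\<integral>\<omega>. Xv \<omega> \<bullet> \<beta> \<partial>M)"
proof -
  have "(\<integral>\<omega>. fY \<omega> \<partial>M) = (\<integral>\<omega>. Xv \<omega> \<bullet> \<beta> + \<epsilon> \<omega> \<partial>M)"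
    using AE_fY fY Xv_scalar_prod_measurable[OF \<beta>_carrier] by (intro integral_cong_AE) auto
  then show ?thesis
    using integrable_Xv_scalar_prod[OF \<beta>_carrier] \<epsilon>_integrable \<epsilon>_centered by simp
qed

text \<open>Bias and variance for deterministic coefficients \<open>b\<close>. As the noise is
  centred, the target is the mean of \<open>Xv \<omega> \<bullet> \<beta>\<close>, so the bias is
  the mean along the error \<open>b - \<beta>\<close>.\<close>

lemma mse_fixed_le:
  fixes P :: "'b measure"
  assumes P: "prob_space P" and iid: "iid_samples P (borel_vec k) (distr M (borel_vec k) Xv) N T"
    and N: "N \<ge> 1" and b: "b \<in> carrier_vec k"
  shows "(\<integral>\<^sup>+\<omega>. ennreal ((LRMC N (\<lambda>l. T l \<omega>) b - (\<integral>\<omega>. fY \<omega> \<partial>M))\<^sup>2) \<partial>P) \<le>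
    ennreal (2 * variance_along \<beta> / real N + 2 * (\<integral>\<omega>. (nrm \<omega>)\<^sup>2 \<partial>M) * (vec_l1 (b - \<beta>))\<^sup>2)"
proof -
  interpret P: prob_space P by fact
  define a where "a = (\<integral>\<omega>. Xv \<omega> \<bullet> b \<partial>M)"
  define \<mu> where "\<mu> = (\<integral>\<omega>. fY \<omega> \<partial>M)"
  define f where "f v = v \<bullet> b - a" for v
  define W where "W l \<omega> = f (T l \<omega>)" for l \<omega>
  have "(\<lambda>v. v \<bullet> b) \<in> borel_measurable (borel_vec k)"
    using b by (intro borel_measurable_scalar_prod[of _ _ k] borel_measurable_vec_index[OF measurable_ident_sets]) auto
  then have f: "f \<in> borel_measurable (borel_vec k)" unfolding f_def by simp
  then have f2: "(\<lambda>v. (f v)\<^sup>2) \<in> borel_measurable (borel_vec k)" by simp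
  have "P.indep_vars (\<lambda>_. borel_vec k) T {..<N}" using iid by (simp add: iid_samples_def)
  then have ind: "P.indep_vars (\<lambda>_. borel) W {..<N}"
    unfolding W_def using f by (rule P.indep_vars_compose2)
  note tr = iid_samples_integrable[OF iid _ P Xv_measurable] iid_samples_integral[OF iid _ P Xv_measurable]
  have int: "integrable P (W l)" if "l < N" for l
    using tr(1)[OF that f] integrable_Xv_scalar_prod[OF b] by (simp add: W_def[abs_def] f_def)
  have int2: "integrable P (\<lambda>\<omega>. (W l \<omega>)\<^sup>2)" if "l < N" for l
    using tr(1)[OF that f2] integrable_square_centered[OF b] by (simp add: W_def f_def)
  have cent: "P.expectation (W l) = 0" if "l < N" for l
    using tr(2)[OF that f] integrable_Xv_scalar_prod[OF b] by (simp add: W_def[abs_def] f_def a_def prob_space)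
  have var: "P.expectation (\<lambda>\<omega>. (W l \<omega>)\<^sup>2) = variance_along b" if "l < N" for l
    using tr(2)[OF that f2] by (simp add: W_def f_def a_def variance_along_def)
  define Sw where "Sw \<omega> = (\<Sum>l<N. W l \<omega>)" for \<omega>
  have Sw2: "integrable P (\<lambda>\<omega>. (Sw \<omega>)\<^sup>2)" "P.expectation (\<lambda>\<omega>. (Sw \<omega>)\<^sup>2) = real N * variance_along b"
    unfolding Sw_def
    using P.integrable_square_sum_indep[OF ind int int2 cent] P.expectation_square_sum_indep[OF ind int int2 cent] var
    by auto
  have Sw1: "integrable P Sw" "P.expectation Sw = 0"
    unfolding Sw_def using int cent by (auto simp: Bochner_Integration.integral_sum)
  \<comment> \<open>The estimate is the target plus the bias plus a centred average; the cross term
    is linear in \<open>Sw\<close> and integrates to zero.\<close>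
  have eq: "(LRMC N (\<lambda>l. T l \<omega>) b - \<mu>)\<^sup>2 =
      (1 / (real N)\<^sup>2) * (Sw \<omega>)\<^sup>2 + (2 * (a - \<mu>) / real N) * Sw \<omega> + (a - \<mu>)\<^sup>2" for \<omega>
  proof -
    have "LRMC N (\<lambda>l. T l \<omega>) b - \<mu> = Sw \<omega> / real N + (a - \<mu>)"
      using N by (simp add: LRMC_def Sw_def W_def f_def sum_subtractf diff_divide_distrib)
    then show ?thesis by (simp add: power2_eq_square algebra_simps add_divide_distrib diff_divide_distrib)
  qed
  have i: "integrable P (\<lambda>\<omega>. (LRMC N (\<lambda>l. T l \<omega>) b - \<mu>)\<^sup>2)" unfolding eq using Sw1 Sw2 by simp
  have "(\<integral>\<^sup>+\<omega>. ennreal ((LRMC N (\<lambda>l. T l \<omega>) b - \<mu>)\<^sup>2) \<partial>P) =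
      ennreal (P.expectation (\<lambda>\<omega>. (LRMC N (\<lambda>l. T l \<omega>) b - \<mu>)\<^sup>2))"
    by (rule nn_integral_eq_integral[OF i]) simp
  also have "P.expectation (\<lambda>\<omega>. (LRMC N (\<lambda>l. T l \<omega>) b - \<mu>)\<^sup>2) = variance_along b / real N + (a - \<mu>)\<^sup>2"
    unfolding eq using Sw1 Sw2 N by (simp add: P.prob_space power2_eq_square)
  also have "\<dots> \<le> 2 * variance_along \<beta> / real N + 2 * (\<integral>\<omega>. (nrm \<omega>)\<^sup>2 \<partial>M) * (vec_l1 (b - \<beta>))\<^sup>2"
  proof -
    have d: "b - \<beta> \<in> carrier_vec k" using b \<beta>_carrier by simp
    have "Xv \<omega> \<bullet> (b - \<beta>) = Xv \<omega> \<bullet> b - Xv \<omega> \<bullet> \<beta>" for \<omega>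
      by (rule scalar_prod_minus_distrib[OF Xv_carrier b \<beta>_carrier])
    then have "(\<integral>\<omega>. Xv \<omega> \<bullet> (b - \<beta>) \<partial>M) = a - \<mu>"
      using integrable_Xv_scalar_prod[OF b] integrable_Xv_scalar_prod[OF \<beta>_carrier]
      by (simp add: a_def \<mu>_def expectation_fY)
    \<comment> \<open>Variance and squared mean along the error add up to its second moment, which
      is controlled by the l1 norm.\<close>
    then have le: "variance_along (b - \<beta>) + (a - \<mu>)\<^sup>2 \<le> (\<integral>\<omega>. (nrm \<omega>)\<^sup>2 \<partial>M) * (vec_l1 (b - \<beta>))\<^sup>2"
      using second_moment_along[OF d] second_moment_along_le[OF d] by (simp add: mult.commute)
    have "variance_along b / real N \<le> (2 * variance_along \<beta> + 2 * variance_along (b - \<beta>)) / real N"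
      using variance_along_le[OF b \<beta>_carrier] by (rule divide_right_mono) simp
    \<comment> \<open>The factor 1/N is given up on the error part, which only then combines with
      the squared bias into the second moment in \<open>le\<close>.\<close>
    also have "\<dots> \<le> 2 * variance_along \<beta> / real N + 2 * variance_along (b - \<beta>)"
      using N variance_along_nonneg[of "b - \<beta>"]
      by (simp add: add_divide_distrib divide_le_eq mult_le_cancel_left1)
    finally show ?thesis using le zero_le_power2[of "a - \<mu>"] by linarith
  qed
  finally show ?thesis unfolding \<mu>_def by (simp add: ennreal_leI)
qed

text \<open>The squared error is a fixed function of the estimator and of the independent samples
  \<open>T\<close>, so freezing turns the conditional expectation into the integral treated in
  \<open>mse_fixed_le\<close>. Conditional expectations are determined up to null sets, hence the
  almost everywhere form.\<close>

lemma MSE_cond_le: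
  fixes P :: "'b measure"
  assumes scheme: "sampling_scheme M n X fY S m N P D T" and N: "N \<ge> 1"
  shows "AE \<omega> in P. MSE_cond P k N T (\<lambda>\<omega>. beta_hat S m (\<lambda>l. D l \<omega>)) (\<integral>\<omega>. fY \<omega> \<partial>M) \<omega> \<le>
    ennreal (2 * variance_along \<beta> / real N +
      2 * (\<integral>\<omega>. (nrm \<omega>)\<^sup>2 \<partial>M) * (vec_l1 (beta_hat S m (\<lambda>l. D l \<omega>) - \<beta>))\<^sup>2)"
proof -
  define \<mu> where "\<mu> = (\<integral>\<omega>. fY \<omega> \<partial>M)"
  define U where "U \<omega> = (\<lambda>l\<in>{..<m}. D l \<omega>)" for \<omega>
  define V where "V \<omega> = (\<lambda>l\<in>{..<N}. T l \<omega>)" for \<omega>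
  define f where "f p = ennreal ((LRMC N (snd p) (fst p) - \<mu>)\<^sup>2)" for p
  from scheme have P: "prob_space P"
    and iidT: "iid_samples P (borel_vec k) (distr M (borel_vec k) Xv) N T"
    and ind: "indep_rv P (\<Pi>\<^sub>M l\<in>{..<m}. joint_space n) U (\<Pi>\<^sub>M l\<in>{..<N}. borel_vec k) V"
    unfolding sampling_scheme_def k_def Xv_def U_def V_def by blast+
  have g: "beta_hat S m \<in> measurable (\<Pi>\<^sub>M l\<in>{..<m}. joint_space n) (borel_vec k)"
    unfolding k_def by (rule measurable_beta_hat[OF S])
  have f: "f \<in> borel_measurable (borel_vec k \<Otimes>\<^sub>M (\<Pi>\<^sub>M l\<in>{..<N}. borel_vec k))"
    unfolding f_def using borel_measurable_LRMC[of N k] by measurable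
  have b: "beta_hat S m (\<lambda>l. D l \<omega>) = beta_hat S m (U \<omega>)" for \<omega>
    unfolding U_def by (rule beta_hat_cong) simp
  have fV: "ennreal ((LRMC N (\<lambda>l. T l \<omega>) w - \<mu>)\<^sup>2) = f (w, V \<omega>)" for w \<omega>
    by (simp add: f_def V_def LRMC_def)
  have "U \<in> measurable P (\<Pi>\<^sub>M l\<in>{..<m}. joint_space n)" using ind by (simp add: indep_rv_def)
  then have bc: "beta_hat S m (U \<omega>) \<in> carrier_vec k" if "\<omega> \<in> space P" for \<omega>
    using measurable_space[OF measurable_compose[OF _ g]] that by fastforce
  have le: "(\<integral>\<^sup>+\<omega>'. f (beta_hat S m (U \<omega>), V \<omega>') \<partial>P) \<le> ennreal (2 * variance_along \<beta> / real N +
      2 * (\<integral>\<omega>. (nrm \<omega>)\<^sup>2 \<partial>M) * (vec_l1 (beta_hat S m (U \<omega>) - \<beta>))\<^sup>2)" if "\<omega> \<in> space P" for \<omega>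
    using mse_fixed_le[OF P iidT N bc[OF that]] unfolding \<mu>_def[symmetric] fV .
  show ?thesis
    using nn_cond_exp_indep_rv[OF P ind g f] AE_space
  proof eventually_elim
    case (elim \<omega>)
    then show ?case
      unfolding MSE_cond_def \<mu>_def[symmetric] b fV using le[OF elim(2)] by simp
  qed
qed

section \<open>Tail bounds for the exploration data\<close>

definition R :: "joint_sample \<Rightarrow> real vec" where "R d = regressor S (fst d)"

text \<open>The noise lives on the model space and is not part of a sample. The residual at the true
  coefficients recovers it, almost surely, as a function of the sample, so that its law transfers to
  the samples on \<open>P\<close>.\<close>

definition e :: "joint_sample \<Rightarrow> real" where "e d = snd d - R d \<bullet> \<beta>"

abbreviation "sample \<equiv> joint_rv n X fY"

abbreviation "second_moment \<equiv> second_moment_mat M k Xv"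

text \<open>Dominates all moments of order at most 6 of the centred product at once; the summand 1
  meets the condition c >= 1 of \<open>prob_sum_indep_ge_le\<close>.\<close>

definition moment_bound :: "nat \<Rightarrow> nat \<Rightarrow> real" where
  "moment_bound i j = 1 + (\<Sum>q\<le>6. \<bar>\<integral>\<omega>. (Xv \<omega> $ i * Xv \<omega> $ j - second_moment $$ (i, j)) ^ q \<partial>M\<bar>)"

lemma sample_measurable: "sample \<in> measurable M (joint_space n)"
  unfolding joint_rv_def joint_space_def using X fY by (intro measurable_Pair measurable_restrict) auto

lemma R_sample: "R (sample \<omega>) = Xv \<omega>"
proof -
  have "finite S" using S finite_subset by blast
  then have "sorted_list_of_set S ! (j - 1) \<in> {1..n}" if "0 < j" "j < card S + 1" for j
  proof -
    have "sorted_list_of_set S ! (j - 1) \<in> S"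
      using that \<open>finite S\<close> nth_mem[of "j - 1" "sorted_list_of_set S"] by simp
    then show ?thesis using S by blast
  qed
  then show ?thesis
    unfolding R_def Xv_def XS_def regressor_def joint_rv_def by (intro eq_vecI) auto
qed

lemma R_index_measurable: "j < k \<Longrightarrow> (\<lambda>d. R d $ j) \<in> borel_measurable (joint_space n)"
  unfolding R_def k_def
  by (rule borel_measurable_vec_index[OF measurable_regressor_joint_space[OF S measurable_ident_sets[OF refl]]])

lemma e_measurable: "e \<in> borel_measurable (joint_space n)"
proof -
  have "snd \<in> borel_measurable (joint_space n)" unfolding joint_space_def by (rule measurable_snd)
  moreover have "(\<lambda>d. R d \<bullet> \<beta>) \<in> borel_measurable (joint_space n)"
    using R_index_measurable \<beta>_carrier by (intro borel_measurable_scalar_prod[of _ _ k]) auto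
  ultimately show ?thesis unfolding e_def[abs_def] by (rule borel_measurable_diff)
qed

lemma AE_e_sample: "AE \<omega> in M. e (sample \<omega>) = \<epsilon> \<omega>"
  using AE_fY by eventually_elim (simp add: e_def R_sample, simp add: joint_rv_def)

lemma second_moment_index: "i < k \<Longrightarrow> j < k \<Longrightarrow> second_moment $$ (i, j) = (\<integral>\<omega>. Xv \<omega> $ i * Xv \<omega> $ j \<partial>M)"
  by (simp add: second_moment_mat_def)

text \<open>
  A product of two sub-exponential variables need not have any exponential moment, but the
  sixth moment already gives the rate \<open>m\<^sup>-\<^sup>3\<close>.
\<close>

lemma gram_tail:
  fixes P :: "'b measure"
  assumes P: "prob_space P" and iid: "iid_samples P (joint_space n) (distr M (joint_space n) sample) m D"
    and ij: "i < k" "j < k" and \<eta>: "\<eta> > 0" and m: "m > 0"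
  shows "measure P {\<omega> \<in> space P.
      \<bar>(\<Sum>l<m. R (D l \<omega>) $ i * R (D l \<omega>) $ j) - real m * second_moment $$ (i, j)\<bar> \<ge> \<eta> * real m}
    \<le> 30 * moment_bound i j ^ 3 / \<eta> ^ 6 / real m ^ 3"
proof -
  interpret P: prob_space P by fact
  define \<Lambda> where "\<Lambda> = second_moment $$ (i, j)"
  define f where "f d = R d $ i * R d $ j - \<Lambda>" for d
  define Y where "Y \<omega> = Xv \<omega> $ i * Xv \<omega> $ j - \<Lambda>" for \<omega>
  have f: "f \<in> borel_measurable (joint_space n)"
    unfolding f_def using R_index_measurable[OF ij(1)] R_index_measurable[OF ij(2)] by simp
  have fq: "(\<lambda>d. f d ^ q) \<in> borel_measurable (joint_space n)" for q using f by simp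
  have fs: "f (sample \<omega>) = Y \<omega>" for \<omega> by (simp add: f_def R_sample Y_def)
  have Yq: "integrable M (\<lambda>\<omega>. Y \<omega> ^ q)" for q
  proof -
    define c where "c p = real (q choose p) * (- \<Lambda>) ^ (q - p)" for p
    have "(\<lambda>\<omega>. Y \<omega> ^ q) = (\<lambda>\<omega>. \<Sum>p\<le>q. c p * (Xv \<omega> $ i * Xv \<omega> $ j) ^ p)"
      unfolding Y_def diff_conv_add_uminus binomial_ring c_def by (simp only: ac_simps)
    moreover have "integrable M (\<lambda>\<omega>. \<Sum>p\<le>q. c p * (Xv \<omega> $ i * Xv \<omega> $ j) ^ p)"
      by (rule Bochner_Integration.integrable_sum, rule integrable_mult_right,
          rule integrable_Xv_prod_power[OF ij])
    ultimately show ?thesis by (simp only:)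
  qed
  note tr = iid_samples_integrable[OF iid _ P sample_measurable] iid_samples_integral[OF iid _ P sample_measurable]
  have bound: "\<bar>\<integral>\<omega>. Y \<omega> ^ q \<partial>M\<bar> \<le> moment_bound i j" if "q \<le> 6" for q
    unfolding moment_bound_def Y_def \<Lambda>_def
    using that member_le_sum[of q "{..6}" "\<lambda>q. \<bar>\<integral>\<omega>. (Xv \<omega> $ i * Xv \<omega> $ j - second_moment $$ (i, j)) ^ q \<partial>M\<bar>"]
    by simp
  have cent: "(\<integral>\<omega>. Y \<omega> \<partial>M) = 0"
    unfolding Y_def using integrable_Xv_prod[OF ij] by (simp add: \<Lambda>_def second_moment_index[OF ij] prob_space)
  have ind: "P.indep_vars (\<lambda>_. borel) (\<lambda>l \<omega>. f (D l \<omega>)) {..<m}"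
    using iid f by (intro P.indep_vars_compose2[where M' = "\<lambda>_. joint_space n" and X = D and Y = "\<lambda>_. f"]) (simp_all add: iid_samples_def)
  have "measure P {\<omega> \<in> space P. \<bar>\<Sum>l<m. f (D l \<omega>)\<bar> \<ge> \<eta> * real m} \<le> 30 * moment_bound i j ^ 3 / \<eta> ^ 6 / real m ^ 3"
  proof (rule P.prob_sum_indep_ge_le[OF ind _ _ _ _ \<eta> m])
    show "integrable P (\<lambda>\<omega>. f (D l \<omega>) ^ q)" if "l < m" for l q
      using tr(1)[OF that fq] Yq by (simp add: fs)
    show "P.expectation (\<lambda>\<omega>. f (D l \<omega>)) = 0" if "l < m" for l
      using tr(2)[OF that f] cent by (simp add: fs)
    show "\<bar>P.expectation (\<lambda>\<omega>. f (D l \<omega>) ^ q)\<bar> \<le> moment_bound i j" if "l < m" "q \<le> 6" for l q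
      using tr(2)[OF that(1) fq] bound[OF that(2)] by (simp add: fs)
    show "1 \<le> moment_bound i j" by (simp add: moment_bound_def sum_nonneg)
  qed
  moreover have "(\<Sum>l<m. f (D l \<omega>)) = (\<Sum>l<m. R (D l \<omega>) $ i * R (D l \<omega>) $ j) - real m * \<Lambda>" for \<omega>
    unfolding f_def sum_subtractf by simp
  ultimately show ?thesis unfolding \<Lambda>_def by (simp only:)
qed

text \<open>
  Self-normalisation: after subtracting the multiple of the squared regressor, integrating over
  the noise first bounds the exponential moment by \<open>1\<close> whatever the law of the regressor is.
\<close>

lemma noise_tail:
  fixes P :: "'b measure"
  assumes P: "prob_space P" and iid: "iid_samples P (joint_space n) (distr M (joint_space n) sample) m D"
    and j: "j < k"
    and v: "\<And>s. (\<integral>\<^sup>+\<omega>. ennreal (exp (s * \<epsilon> \<omega>)) \<partial>M) \<le> ennreal (exp (v * s\<^sup>2))"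
  shows "measure P {\<omega> \<in> space P.
      (\<Sum>l<m. \<tau> * (R (D l \<omega>) $ j * e (D l \<omega>)) - v * \<tau>\<^sup>2 * (R (D l \<omega>) $ j)\<^sup>2) \<ge> t} \<le> exp (- t)"
proof -
  interpret P: prob_space P by fact
  define f where "f d = \<tau> * (R d $ j * e d) - v * \<tau>\<^sup>2 * (R d $ j)\<^sup>2" for d
  have f: "f \<in> borel_measurable (joint_space n)"
    unfolding f_def using R_index_measurable[OF j] e_measurable by simp
  have ind: "P.indep_vars (\<lambda>_. borel) (\<lambda>l \<omega>. f (D l \<omega>)) {..<m}"
    using iid f by (intro P.indep_vars_compose2[where M' = "\<lambda>_. joint_space n" and X = D and Y = "\<lambda>_. f"]) (simp_all add: iid_samples_def)
  define g where "g p = ennreal (exp (\<tau> * (fst p $ j * snd p) - v * \<tau>\<^sup>2 * (fst p $ j)\<^sup>2))" for p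
  have [measurable]: "(\<lambda>p. fst p $ j) \<in> borel_measurable (borel_vec k \<Otimes>\<^sub>M borel)"
    by (rule borel_measurable_vec_index[OF measurable_fst j])
  have g: "g \<in> borel_measurable (borel_vec k \<Otimes>\<^sub>M borel)"
    unfolding g_def by measurable
  have inner: "(\<integral>\<^sup>+\<omega>'. g (x, \<epsilon> \<omega>') \<partial>M) \<le> 1" for x
  proof -
    \<comment> \<open>For a fixed regressor the exponent is s times the noise minus v s^2, and the
      correction cancels the bound on the exponential moment exactly.\<close>
    define s where "s = \<tau> * x $ j"
    have "(\<integral>\<^sup>+\<omega>'. g (x, \<epsilon> \<omega>') \<partial>M) = (\<integral>\<^sup>+\<omega>'. ennreal (exp (- (v * s\<^sup>2))) * ennreal (exp (s * \<epsilon> \<omega>')) \<partial>M)"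
      by (intro nn_integral_cong)
         (simp add: g_def s_def power_mult_distrib mult.assoc flip: ennreal_mult exp_add)
    also have "\<dots> = ennreal (exp (- (v * s\<^sup>2))) * (\<integral>\<^sup>+\<omega>'. ennreal (exp (s * \<epsilon> \<omega>')) \<partial>M)"
      by (rule nn_integral_cmult) measurable
    also have "\<dots> \<le> ennreal (exp (- (v * s\<^sup>2))) * ennreal (exp (v * s\<^sup>2))"
      by (rule mult_left_mono[OF v]) simp
    also have "\<dots> = 1" by (simp flip: ennreal_mult exp_add)
    finally show ?thesis .
  qed
  have "(\<integral>\<^sup>+\<omega>. ennreal (exp (f (sample \<omega>))) \<partial>M) = (\<integral>\<^sup>+\<omega>. g (Xv \<omega>, \<epsilon> \<omega>) \<partial>M)"
  proof (rule nn_integral_cong_AE)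
    show "AE \<omega> in M. ennreal (exp (f (sample \<omega>))) = g (Xv \<omega>, \<epsilon> \<omega>)"
      using AE_e_sample by eventually_elim (simp add: f_def g_def R_sample)
  qed
  also have "\<dots> = (\<integral>\<^sup>+\<omega>. (\<integral>\<^sup>+\<omega>'. g (Xv \<omega>, \<epsilon> \<omega>') \<partial>M) \<partial>M)"
    by (rule nn_integral_indep_rv[OF prob_space_axioms indep_rv_commute[OF prob_space_axioms \<epsilon>_indep] g])
  also have "\<dots> \<le> (\<integral>\<^sup>+\<omega>. 1 \<partial>M)" by (intro nn_integral_mono inner)
  finally have "(\<integral>\<^sup>+\<omega>. ennreal (exp (f (sample \<omega>))) \<partial>M) \<le> 1" by (simp add: emeasure_space_1)
  moreover have "(\<lambda>d. ennreal (exp (f d))) \<in> borel_measurable (joint_space n)" using f by measurable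
  note iid_samples_nn_integral[OF iid _ P sample_measurable this]
  ultimately have "(\<integral>\<^sup>+\<omega>. ennreal (exp (f (D l \<omega>))) \<partial>P) \<le> 1" if "l < m" for l
    using that by simp
  from P.indep_vars_chernoff[OF ind this, of t] show ?thesis unfolding f_def by simp
qed

lemma AE_noise_eq_0:
  fixes P :: "'b measure"
  assumes P: "prob_space P" and iid: "iid_samples P (joint_space n) (distr M (joint_space n) sample) m D"
    and \<sigma>: "\<sigma> = 0"
  shows "AE \<omega> in P. \<forall>l\<in>{..<m}. e (D l \<omega>) = 0"
proof (rule AE_finite_allI)
  fix l assume l: "l \<in> {..<m}"
  have "AE \<omega> in M. e (sample \<omega>) = 0" using AE_e_sample \<epsilon>_eq_0[OF \<sigma>] by eventually_elim simp
  moreover have "{d \<in> space (joint_space n). e d = 0} \<in> sets (joint_space n)"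
    using e_measurable by measurable
  ultimately show "AE \<omega> in P. e (D l \<omega>) = 0"
    using iid_samples_AE[OF iid _ P sample_measurable, of l "\<lambda>d. e d = 0"] l by simp
qed simp

text \<open>All constants are fixed from the law before \<open>m\<close>, \<open>P\<close> and
  \<open>D\<close> appear. The \<open>Q\<close> defined inside the proof bounds the l1 error by
  \<open>Q * \<tau>\<close>; the witness for the statement is
  \<open>Q\<^sup>2 / \<sigma>\<^sup>2\<close>, as the noise bound itself does not scale with
  \<sigma>.\<close>

lemma beta_hat_error_tail:
  assumes inv: "invertible_mat second_moment"
  shows "\<exists>Q\<ge>0. \<exists>m\<^sub>0. \<forall>m\<ge>m\<^sub>0. \<forall>(P :: 'b measure) D. prob_space P \<longrightarrow>
    iid_samples P (joint_space n) (distr M (joint_space n) sample) m D \<longrightarrow>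
    (\<exists>A\<in>sets P. measure P A \<le> 1 / (real m)\<^sup>2 \<and>
      (AE \<omega> in P. \<omega> \<notin> A \<longrightarrow>
        (vec_l1 (beta_hat S m (\<lambda>l. D l \<omega>) - \<beta>))\<^sup>2 \<le> Q * \<sigma>\<^sup>2 * (ln (real m) / real m)))"
proof -
  have \<Lambda>: "second_moment \<in> carrier_mat k k" by (simp add: second_moment_mat_def)
  from inv obtain L where L1: "second_moment * L = 1\<^sub>m k" and L2: "L * second_moment = 1\<^sub>m (dim_row L)"
    using \<Lambda> by (auto simp: invertible_mat_def inverts_mat_def)
  have "dim_col L = k" using arg_cong[OF L1, of dim_col] by simp
  moreover have "dim_row L = k" using arg_cong[OF L2, of dim_col] \<Lambda> by simp
  ultimately have L: "L \<in> carrier_mat k k" and L\<Lambda>: "L * second_moment = 1\<^sub>m k" using L2 by auto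
  obtain v where v0: "v > 0"
    and v: "\<And>s. (\<integral>\<^sup>+\<omega>. ennreal (exp (s * \<epsilon> \<omega>)) \<partial>M) \<le> ennreal (exp (v * s\<^sup>2))"
    by (rule \<epsilon>_mgf) blast
  define r where "r = (\<Sum>i<k. \<Sum>j<k. \<bar>L $$ (i, j)\<bar>)"
  have r0: "r \<ge> 0" by (simp add: r_def sum_nonneg)
  have r: "\<bar>L $$ (i, j)\<bar> \<le> r" if "i < k" "j < k" for i j
  proof -
    have "\<bar>L $$ (i, j)\<bar> \<le> (\<Sum>j<k. \<bar>L $$ (i, j)\<bar>)"
      using that by (intro member_le_sum[of j "{..<k}" "\<lambda>j. \<bar>L $$ (i, j)\<bar>"]) auto
    also have "\<dots> \<le> r"
      unfolding r_def using that
      by (intro member_le_sum[of i "{..<k}" "\<lambda>i. \<Sum>j<k. \<bar>L $$ (i, j)\<bar>"]) (auto simp: sum_nonneg)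
    finally show ?thesis .
  qed
  have k: "k \<ge> 1" by (simp add: k_def)
  \<comment> \<open>Chosen so that k r * k \<eta> = r / (2 (r + 1)) is at most 1/2, the smallness
    under which the perturbation is absorbed; r + 1 keeps the denominator positive.\<close>
  define \<eta> where "\<eta> = 1 / (2 * (real k)\<^sup>2 * (r + 1))"
  have \<eta>: "\<eta> > 0" using k r0 by (simp add: \<eta>_def)
  have small: "real k * r * (real k * \<eta>) \<le> 1 / 2"
  proof -
    have "real k * r * (real k * \<eta>) = 1 / 2 * (r / (r + 1))"
      using k r0 by (simp add: \<eta>_def power2_eq_square)
    also have "\<dots> \<le> 1 / 2 * 1" using r0 by (intro mult_left_mono) auto
    finally show ?thesis by simp
  qed
  \<comment> \<open>Bounds the diagonal of the normalised Gram matrix, that is the mean squared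
    regressor entries, outside the bad event.\<close>
  define a where "a = (\<Sum>j<k. \<bar>second_moment $$ (j, j)\<bar>) + \<eta>"
  have a: "\<bar>second_moment $$ (j, j)\<bar> + \<eta> \<le> a" if "j < k" for j
    unfolding a_def using that member_le_sum[of j "{..<k}" "\<lambda>j. \<bar>second_moment $$ (j, j)\<bar>"] by simp
  have a0: "a \<ge> 0" unfolding a_def using \<eta> by (simp add: sum_nonneg)
  \<comment> \<open>The coefficient of m^-3 in the union bound over all entries of the Gram
    matrix.\<close>
  define CG where "CG = (\<Sum>i<k. \<Sum>j<k. 30 * moment_bound i j ^ 3 / \<eta> ^ 6)"
  \<comment> \<open>The factor 2 k r comes from inverting the Gram matrix, the second k from summing
    over coordinates, and v a + 3 from the noise bound per coordinate.\<close>
  define Q where "Q = 2 * real k * r * (real k * (v * a + 3))"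
  \<comment> \<open>The value 2 makes ln m positive; the other part turns the total (CG + 2 k) / m^3
    into at most 1 / m^2.\<close>
  define m\<^sub>0 where "m\<^sub>0 = max 2 (nat \<lceil>CG + 2 * real k\<rceil>)"
  have Q0: "Q \<ge> 0" using r0 v0 a0 by (simp add: Q_def)
  have main: "\<exists>A\<in>sets P. measure P A \<le> 1 / (real m)\<^sup>2 \<and>
      (AE \<omega> in P. \<omega> \<notin> A \<longrightarrow>
        (vec_l1 (beta_hat S m (\<lambda>l. D l \<omega>) - \<beta>))\<^sup>2 \<le> (Q\<^sup>2 / \<sigma>\<^sup>2) * \<sigma>\<^sup>2 * (ln (real m) / real m))"
    if mm: "m \<ge> m\<^sub>0" and P: "prob_space P"
      and iid: "iid_samples P (joint_space n) (distr M (joint_space n) sample) m D"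
    for m and P :: "'b measure" and D
  proof -
    interpret P: prob_space P by fact
    have m2: "m \<ge> 2" and mC: "CG + 2 * real k \<le> real m" using mm by (auto simp: m\<^sub>0_def)
    define lm where "lm = ln (real m)"
    have lm: "lm > 0" using m2 by (simp add: lm_def)
    \<comment> \<open>With this choice \<tau>^2 m = ln m, so the quadratic correction and the
      threshold 3 ln m are both multiples of ln m; dividing by \<tau> leaves noise sums of order
      \<tau> m.\<close>
    define \<tau> where "\<tau> = sqrt (lm / real m)"
    have \<tau>: "\<tau> > 0" using lm m2 by (simp add: \<tau>_def)
    have \<tau>2: "\<tau>\<^sup>2 = lm / real m" using lm by (simp add: \<tau>_def)
    have lm_eq: "lm = \<tau>\<^sup>2 * real m" using m2 by (simp add: \<tau>2)
    have exp3: "exp (- (3 * lm)) = 1 / real m ^ 3"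
    proof -
      have "exp (3 * lm) = exp lm ^ 3" using exp_of_nat_mult[of 3 lm] by simp
      then show ?thesis using m2 by (simp add: lm_def exp_minus inverse_eq_divide)
    qed
    define BG where "BG i j = {\<omega> \<in> space P.
      \<bar>(\<Sum>l<m. R (D l \<omega>) $ i * R (D l \<omega>) $ j) - real m * second_moment $$ (i, j)\<bar> \<ge> \<eta> * real m}" for i j
    \<comment> \<open>The threshold 3 ln m has Chernoff probability m^-3. The parameter
      \<open>s\<close> will be \<tau> and -\<tau>, which gives a two-sided bound.\<close>
    define BE where "BE s j = {\<omega> \<in> space P.
      (\<Sum>l<m. s * (R (D l \<omega>) $ j * e (D l \<omega>)) - v * s\<^sup>2 * (R (D l \<omega>) $ j)\<^sup>2) \<ge> 3 * lm}" for s j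
    have Dm: "D l \<in> measurable P (joint_space n)" if "l < m" for l
      by (rule iid_samples_measurable[OF iid that P sample_measurable])
    have mR: "(\<lambda>\<omega>. R (D l \<omega>) $ j) \<in> borel_measurable P" if "l < m" "j < k" for l j
      by (rule measurable_compose[OF Dm[OF that(1)] R_index_measurable[OF that(2)]])
    have me: "(\<lambda>\<omega>. e (D l \<omega>)) \<in> borel_measurable P" if "l < m" for l
      by (rule measurable_compose[OF Dm[OF that] e_measurable])
    have BG: "BG i j \<in> sets P" if "i < k" "j < k" for i j
    proof -
      have [measurable]: "(\<lambda>\<omega>. \<Sum>l<m. R (D l \<omega>) $ i * R (D l \<omega>) $ j) \<in> borel_measurable P"
        using mR that by (intro borel_measurable_sum borel_measurable_times) auto
      show ?thesis unfolding BG_def by measurable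
    qed
    have BE: "BE s j \<in> sets P" if "j < k" for s j
    proof -
      have [measurable]: "(\<lambda>\<omega>. \<Sum>l<m. s * (R (D l \<omega>) $ j * e (D l \<omega>)) - v * s\<^sup>2 * (R (D l \<omega>) $ j)\<^sup>2) \<in> borel_measurable P"
        using mR me that
        by (intro borel_measurable_sum borel_measurable_diff borel_measurable_times borel_measurable_power borel_measurable_const) auto
      show ?thesis unfolding BE_def by measurable
    qed
    define A1 where "A1 = (\<Union>i<k. \<Union>j<k. BG i j)"
    define A2 where "A2 s = (\<Union>j<k. BE s j)" for s
    have A1: "A1 \<in> sets P" unfolding A1_def using BG by (intro sets.finite_UN) auto
    have A2: "A2 s \<in> sets P" for s unfolding A2_def using BE by (intro sets.finite_UN) auto
    have "measure P A1 \<le> (\<Sum>i<k. measure P (\<Union>j<k. BG i j))"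
      unfolding A1_def using BG by (intro measure_UNION_le sets.finite_UN) auto
    also have "\<dots> \<le> (\<Sum>i<k. \<Sum>j<k. measure P (BG i j))"
      using BG by (intro sum_mono measure_UNION_le) auto
    also have "\<dots> \<le> (\<Sum>i<k. \<Sum>j<k. 30 * moment_bound i j ^ 3 / \<eta> ^ 6 / real m ^ 3)"
      unfolding BG_def using m2 by (intro sum_mono gram_tail[OF P iid _ _ \<eta>]) auto
    also have "\<dots> = CG / real m ^ 3" by (simp add: CG_def sum_divide_distrib)
    finally have pA1: "measure P A1 \<le> CG / real m ^ 3" .
    have pA2: "measure P (A2 s) \<le> real k / real m ^ 3" for s
    proof -
      have "measure P (A2 s) \<le> (\<Sum>j<k. measure P (BE s j))"
        unfolding A2_def using BE by (intro measure_UNION_le) auto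
      also have "\<dots> \<le> (\<Sum>j<k. exp (- (3 * lm)))"
        unfolding BE_def by (intro sum_mono noise_tail[OF P iid _ v]) auto
      finally show ?thesis by (simp add: exp3)
    qed
    define A where "A = A1 \<union> (A2 \<tau> \<union> A2 (- \<tau>))"
    have A: "A \<in> sets P" unfolding A_def using A1 A2 by auto
    have "measure P A \<le> measure P A1 + (measure P (A2 \<tau>) + measure P (A2 (- \<tau>)))"
      unfolding A_def using A1 A2
      by (intro order_trans[OF measure_Un_le] add_left_mono measure_Un_le sets.Un) auto
    also have "\<dots> \<le> CG / real m ^ 3 + (real k / real m ^ 3 + real k / real m ^ 3)"
      by (intro add_mono pA1 pA2)
    also have "\<dots> = (CG + 2 * real k) / real m ^ 3" by (simp add: add_divide_distrib)
    also have "\<dots> \<le> real m / real m ^ 3" using mC by (intro divide_right_mono) auto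
    also have "\<dots> = 1 / (real m)\<^sup>2" using m2 by (simp add: power2_eq_square power3_eq_cube)
    finally have pA: "measure P A \<le> 1 / (real m)\<^sup>2" .
    \<comment> \<open>Two forms are kept: the first shows that the error vanishes with the noise, as
      needed for \<sigma> = 0; the second is the rate used otherwise.\<close>
    have good: "real m * vec_l1 (beta_hat S m (\<lambda>l. D l \<omega>) - \<beta>) \<le>
        2 * real k * r * (\<Sum>j<k. \<bar>\<Sum>l<m. R (D l \<omega>) $ j * e (D l \<omega>)\<bar>)
        \<and> vec_l1 (beta_hat S m (\<lambda>l. D l \<omega>) - \<beta>) \<le> Q * \<tau>"
      if \<omega>: "\<omega> \<in> space P" "\<omega> \<notin> A" for \<omega>
    proof -
      have gram: "\<bar>(\<Sum>l<m. R (D l \<omega>) $ i * R (D l \<omega>) $ j) - real m * second_moment $$ (i, j)\<bar> \<le> real m * \<eta>"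
        if "i < k" "j < k" for i j
        using \<omega> that by (force simp: A_def A1_def BG_def mult.commute)
      have err: "real m * vec_l1 (beta_hat S m (\<lambda>l. D l \<omega>) - \<beta>) \<le>
          2 * real k * r * (\<Sum>j<k. \<bar>\<Sum>l<m. R (D l \<omega>) $ j * e (D l \<omega>)\<bar>)"
        by (rule vec_l1_beta_hat_error_le[where S = S and d = "\<lambda>l. D l \<omega>" and \<beta> = \<beta>,
              folded k_def R_def, folded e_def, OF L r r0 \<Lambda> L\<Lambda> gram small _ \<beta>_carrier])
           (use m2 in simp_all)
      have noise: "\<bar>\<Sum>l<m. R (D l \<omega>) $ j * e (D l \<omega>)\<bar> \<le> (v * a + 3) * (\<tau> * real m)" if j: "j < k" for j
      proof -
        define G where "G = (\<Sum>l<m. R (D l \<omega>) $ j * e (D l \<omega>))"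
        define H where "H = (\<Sum>l<m. (R (D l \<omega>) $ j)\<^sup>2)"
        have "\<omega> \<notin> BE s j" if "s = \<tau> \<or> s = - \<tau>" for s
          using \<omega> j that by (auto simp: A_def A2_def)
        then have lt: "s * G - v * s\<^sup>2 * H < 3 * lm" if "s = \<tau> \<or> s = - \<tau>" for s
          using \<omega>(1) that unfolding BE_def G_def H_def sum_subtractf sum_distrib_left by fastforce
        \<comment> \<open>The Gram event is used a second time: its diagonal entries replace the
          random correction \<open>H\<close> by a deterministic bound.\<close>
        have "H \<le> real m * a"
        proof -
          have "H - real m * second_moment $$ (j, j) \<le> real m * \<eta>"
            using gram[OF j j] by (simp add: H_def power2_eq_square)
          moreover have "real m * (second_moment $$ (j, j) + \<eta>) \<le> real m * a"
            using a[OF j] by (intro mult_left_mono) auto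
          ultimately show ?thesis by (simp add: distrib_left)
        qed
        then have "v * \<tau>\<^sup>2 * H \<le> v * \<tau>\<^sup>2 * (real m * a)" using v0 by (intro mult_left_mono) auto
        moreover have "\<tau> * G \<le> v * \<tau>\<^sup>2 * H + 3 * lm" "- (\<tau> * G) \<le> v * \<tau>\<^sup>2 * H + 3 * lm"
          using lt[of \<tau>] lt[of "- \<tau>"] by simp_all
        ultimately have "\<bar>\<tau> * G\<bar> \<le> v * \<tau>\<^sup>2 * (real m * a) + 3 * lm" by linarith
        also have "\<dots> = \<tau> * ((v * a + 3) * (\<tau> * real m))"
          by (simp add: lm_eq power2_eq_square algebra_simps)
        finally show ?thesis using \<tau> unfolding G_def[symmetric] by (simp add: abs_mult)
      qed
      have "(\<Sum>j<k. \<bar>\<Sum>l<m. R (D l \<omega>) $ j * e (D l \<omega>)\<bar>) \<le> (\<Sum>j<k. (v * a + 3) * (\<tau> * real m))"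
        using noise by (intro sum_mono) auto
      then have "2 * real k * r * (\<Sum>j<k. \<bar>\<Sum>l<m. R (D l \<omega>) $ j * e (D l \<omega>)\<bar>) \<le>
          2 * real k * r * (\<Sum>j<k. (v * a + 3) * (\<tau> * real m))"
        using r0 by (intro mult_left_mono) auto
      also have "\<dots> = real m * (Q * \<tau>)" by (simp add: Q_def)
      finally have "real m * vec_l1 (beta_hat S m (\<lambda>l. D l \<omega>) - \<beta>) \<le> real m * (Q * \<tau>)"
        using err by linarith
      then have "vec_l1 (beta_hat S m (\<lambda>l. D l \<omega>) - \<beta>) \<le> Q * \<tau>" using m2 by simp
      with err show ?thesis ..
    qed
    have "AE \<omega> in P. \<omega> \<notin> A \<longrightarrow>
        (vec_l1 (beta_hat S m (\<lambda>l. D l \<omega>) - \<beta>))\<^sup>2 \<le> (Q\<^sup>2 / \<sigma>\<^sup>2) * \<sigma>\<^sup>2 * (ln (real m) / real m)"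
    proof (cases "\<sigma> = 0")
      case True
      \<comment> \<open>Here \<open>Q\<^sup>2 / \<sigma>\<^sup>2\<close> is the junk value \<open>0\<close>, so the estimator has to be exact.\<close>
      show ?thesis
        using AE_noise_eq_0[OF P iid True] AE_space
      proof eventually_elim
        case (elim \<omega>)
        show ?case
        proof
          assume "\<omega> \<notin> A"
          from good[OF elim(2) this] elim(1)
          have "real m * vec_l1 (beta_hat S m (\<lambda>l. D l \<omega>) - \<beta>) \<le> 0" by simp
          then have "vec_l1 (beta_hat S m (\<lambda>l. D l \<omega>) - \<beta>) = 0"
            using m2 vec_l1_nonneg[of "beta_hat S m (\<lambda>l. D l \<omega>) - \<beta>"] by (simp add: mult_le_0_iff)
          then show "(vec_l1 (beta_hat S m (\<lambda>l. D l \<omega>) - \<beta>))\<^sup>2 \<le> (Q\<^sup>2 / \<sigma>\<^sup>2) * \<sigma>\<^sup>2 * (ln (real m) / real m)"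
            using True by simp
        qed
      qed
    next
      case False
      show ?thesis
        using AE_space
      proof eventually_elim
        case (elim \<omega>)
        show ?case
        proof
          assume "\<omega> \<notin> A"
          from good[OF elim this]
          have "(vec_l1 (beta_hat S m (\<lambda>l. D l \<omega>) - \<beta>))\<^sup>2 \<le> (Q * \<tau>)\<^sup>2" by (intro power_mono) auto
          also have "\<dots> = (Q\<^sup>2 / \<sigma>\<^sup>2) * \<sigma>\<^sup>2 * (ln (real m) / real m)"
            using False by (simp add: power_mult_distrib \<tau>2 lm_def)
          finally show "(vec_l1 (beta_hat S m (\<lambda>l. D l \<omega>) - \<beta>))\<^sup>2 \<le> (Q\<^sup>2 / \<sigma>\<^sup>2) * \<sigma>\<^sup>2 * (ln (real m) / real m)" .
        qed
      qed
    qed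
    with A pA show ?thesis by blast
  qed
  show ?thesis
    by (rule exI[of _ "Q\<^sup>2 / \<sigma>\<^sup>2"], intro conjI exI[of _ m\<^sub>0] allI impI main) auto
qed

end

theorem theorem4p2:
  fixes M :: "'a measure" and n :: nat
    and X :: "nat \<Rightarrow> 'a \<Rightarrow> real" and fY :: "'a \<Rightarrow> real"
    and c :: "nat \<Rightarrow> real" and S :: "nat set"
    and \<beta> :: "real vec" and \<epsilon> :: "'a \<Rightarrow> real" and \<sigma> K :: real
  assumes "prob_space M"
    and "\<forall>i\<in>{1..n}. X i \<in> borel_measurable M"
    and "fY \<in> borel_measurable M"
    and "\<forall>i\<in>{0..n}. c i > 0"
    and "S \<noteq> {}" and "S \<subseteq> {1..n}"
    and "linear_model M X fY S \<beta> \<epsilon> \<sigma>"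
    and "K \<ge> 1"
    and "max (SUP \<theta>\<in>{\<theta> \<in> carrier_vec (card S + 1). vec_norm2 \<theta> = 1}.
                L4_norm M (\<lambda>\<omega>. XS X S \<omega> \<bullet> \<theta>))
             (psi_norm M 1 (\<lambda>\<omega>. vec_norm2 (XS X S \<omega>))) \<le> ennreal K"
    and "invertible_mat (second_moment_mat M (card S + 1) (XS X S))"
  shows "\<exists>C>0. \<exists>m\<^sub>0::nat. \<forall>m\<ge>m\<^sub>0. \<forall>B>0.
           \<forall>(P :: 'b measure) D T.
             m > n + 1 \<longrightarrow>
             N_ept c n S m B \<ge> 1 \<longrightarrow>
             sampling_scheme M n X fY S m (N_ept c n S m B) P D T \<longrightarrow>
             measure P {\<omega> \<in> space P.
               MSE_cond P (card S + 1) (N_ept c n S m B) T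
                   (\<lambda>\<omega>. beta_hat S m (\<lambda>l. D l \<omega>)) (\<integral>\<omega>. fY \<omega> \<partial>M) \<omega>
               \<le> ennreal (C * ((\<beta> \<bullet> (cov_mat M (card S + 1) (XS X S) *\<^sub>v \<beta>)) / real (N_ept c n S m B)
                              + real (card S + 1) * \<sigma>\<^sup>2 * (ln (real m) / real m)))}
             \<ge> 1 - 1 / (real m)\<^sup>2"
proof -
  interpret prob_space M by fact
  have "psi_norm M 1 (\<lambda>\<omega>. vec_norm2 (XS X S \<omega>)) < \<infinity>"
    using assms(9) by (auto intro: le_less_trans)
  then interpret regression_model M n X fY S \<beta> \<epsilon> \<sigma>
    using assms by unfold_locales auto
  have "invertible_mat second_moment" using assms(10) unfolding k_def Xv_def .
  from beta_hat_error_tail[OF this, where 'b = 'b] obtain Q m\<^sub>0 where Q: "Q \<ge> 0"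
    and tail: "\<And>m (P :: 'b measure) D. m \<ge> m\<^sub>0 \<Longrightarrow> prob_space P \<Longrightarrow>
      iid_samples P (joint_space n) (distr M (joint_space n) sample) m D \<Longrightarrow>
      \<exists>A\<in>sets P. measure P A \<le> 1 / (real m)\<^sup>2 \<and> (AE \<omega> in P. \<omega> \<notin> A \<longrightarrow>
        (vec_l1 (beta_hat S m (\<lambda>l. D l \<omega>) - \<beta>))\<^sup>2 \<le> Q * \<sigma>\<^sup>2 * (ln (real m) / real m))"
    by blast
  define a where "a = (\<integral>\<omega>. (nrm \<omega>)\<^sup>2 \<partial>M)"
  have a: "a \<ge> 0" unfolding a_def by (intro Bochner_Integration.integral_nonneg) simp
  \<comment> \<open>The 2 covers the variance along \<beta> and makes C positive; 2 a Q is twice E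
    |X|^2 times the constant of the squared l1 error.\<close>
  define C where "C = 2 + 2 * a * Q"
  have C: "C \<ge> 2" using a Q by (simp add: C_def)
  have main: "1 - 1 / (real m)\<^sup>2 \<le> measure P {\<omega> \<in> space P.
      MSE_cond P k N T (\<lambda>\<omega>. beta_hat S m (\<lambda>l. D l \<omega>)) (\<integral>\<omega>. fY \<omega> \<partial>M) \<omega>
      \<le> ennreal (C * ((\<beta> \<bullet> (cov_mat M k Xv *\<^sub>v \<beta>)) / real N + real k * \<sigma>\<^sup>2 * (ln (real m) / real m)))}"
    if m: "m \<ge> m\<^sub>0" and m1: "m > n + 1" and N: "N \<ge> 1" and scheme: "sampling_scheme M n X fY S m N P D T"
    for m N and P :: "'b measure" and D T
  proof -
    from scheme have P: "prob_space P"
      and iid: "iid_samples P (joint_space n) (distr M (joint_space n) sample) m D"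
      by (simp_all add: sampling_scheme_def)
    interpret P: prob_space P by fact
    define mse where "mse = MSE_cond P k N T (\<lambda>\<omega>. beta_hat S m (\<lambda>l. D l \<omega>)) (\<integral>\<omega>. fY \<omega> \<partial>M)"
    define \<rho> where "\<rho> = \<sigma>\<^sup>2 * (ln (real m) / real m)"
    have \<rho>: "\<rho> \<ge> 0" using m1 by (simp add: \<rho>_def)
    \<comment> \<open>Without this the event of the claim might not be measurable and
      \<open>measure\<close> would fall back to 0.\<close>
    have [measurable]: "mse \<in> borel_measurable P"
      unfolding mse_def MSE_cond_def by (rule borel_measurable_nn_cond_exp2)
    from tail[OF m P iid] obtain A where A: "A \<in> sets P" "measure P A \<le> 1 / (real m)\<^sup>2"
      and AE_A: "AE \<omega> in P. \<omega> \<notin> A \<longrightarrow>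
        (vec_l1 (beta_hat S m (\<lambda>l. D l \<omega>) - \<beta>))\<^sup>2 \<le> Q * \<sigma>\<^sup>2 * (ln (real m) / real m)"
      by blast
    have bound: "2 * variance_along \<beta> / real N + 2 * a * z \<le> C * (variance_along \<beta> / real N + real k * \<rho>)"
      if "z \<le> Q * \<rho>" for z
    proof -
      have "2 * a * z \<le> 2 * a * (Q * \<rho>)" using that a by (intro mult_left_mono) auto
      also have "\<dots> \<le> C * \<rho>" using \<rho> by (simp add: C_def algebra_simps)
      \<comment> \<open>The factor s + 1 of the claim enters here simply because k >= 1.\<close>
      also have "\<dots> \<le> C * (real k * \<rho>)"
        using C \<rho> by (intro mult_left_mono) (auto simp: k_def distrib_right)
      finally have "2 * a * z \<le> C * (real k * \<rho>)" .
      moreover have "2 * (variance_along \<beta> / real N) \<le> C * (variance_along \<beta> / real N)"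
        using C variance_along_nonneg by (intro mult_right_mono) auto
      ultimately show ?thesis by (simp add: distrib_left)
    qed
    have "1 - 1 / (real m)\<^sup>2 \<le> 1 - measure P A" using A by simp
    also have "\<dots> = measure P (space P - A)" using A(1) by (simp add: P.prob_compl)
    also have "\<dots> \<le> measure P {\<omega> \<in> space P. mse \<omega> \<le>
        ennreal (C * (variance_along \<beta> / real N + real k * \<rho>))}"
    proof (rule P.finite_measure_mono_AE)
      \<comment> \<open>Both the estimator bound and the bound on the conditional error hold only
        almost everywhere, so the complement of \<open>A\<close> lies in the good event up to a null
        set.\<close>
      show "AE \<omega> in P. \<omega> \<in> space P - A \<longrightarrow>
          \<omega> \<in> {\<omega> \<in> space P. mse \<omega> \<le> ennreal (C * (variance_along \<beta> / real N + real k * \<rho>))}"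
        using AE_A MSE_cond_le[OF scheme N]
      proof eventually_elim
        case (elim \<omega>)
        show ?case
        proof
          assume \<omega>: "\<omega> \<in> space P - A"
          have "(vec_l1 (beta_hat S m (\<lambda>l. D l \<omega>) - \<beta>))\<^sup>2 \<le> Q * \<rho>"
            using elim(1) \<omega> by (simp add: \<rho>_def mult.assoc)
          from elim(2) ennreal_leI[OF bound[OF this]]
          have "mse \<omega> \<le> ennreal (C * (variance_along \<beta> / real N + real k * \<rho>))"
            unfolding mse_def a_def by (rule order_trans)
          with \<omega> show "\<omega> \<in> {\<omega> \<in> space P. mse \<omega> \<le> ennreal (C * (variance_along \<beta> / real N + real k * \<rho>))}"
            by simp
        qed
      qed
      show "{\<omega> \<in> space P. mse \<omega> \<le> ennreal (C * (variance_along \<beta> / real N + real k * \<rho>))} \<in> sets P"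
        by measurable
    qed
    finally show ?thesis
      by (simp only: cov_mat_quadratic_form[OF \<beta>_carrier] mse_def \<rho>_def mult.assoc)
  qed
  have "C > 0" using C by simp
  then show ?thesis using main[unfolded k_def Xv_def] by blast
qed

end
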